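(* There is an absolute constant $C>0$ such that the following holds. Let $A$ be the adjacency matrix of a random graph on $n$ vertices drawn from the inhomogeneous Erdős–Rényi model $G(n,(p_{ij}))$, and let $d=\max_{i,j} n p_{ij}$. Choose a number $\tau>0$. Then, for any $r\ge 1$, with probability at least $1-e^{-r}$ one has $$\|\mathcal{L}(A_\tau)-\mathcal{L}(\mathbb{E}A_\tau)\|\le \frac{Cr^2}{\sqrt{\tau}}\Big(1+\frac{d}{\tau}\Big)^{5/2}.$$
   Context: The inhomogeneous Erdős–Rényi model $G(n,(p_{ij}))$: $(p_{ij})$ is a symmetric $n\times n$ matrix with entries in $[0,1]$, and edges of an undirected graph on the vertex set $\{1,\dots,n\}$ are formed independently, the edge $\{i,j\}$ being present with probability $p_{ij}$. Thus $A$ is a symmetric random matrix with entries in $\{0,1\}$, with $A_{ij}$, $i\le j$, independent and $\mathbb{P}\{A_{ij}=1\}=p_{ij}$ (loops may be excluded by taking $p_{ii}=0$). For a symmetric matrix $B$ with nonnegative entries and positive row sums, the (symmetric, normalized) Laplacian is $\mathcal{L}(B)=I-D^{-1/2}BD^{-1/2}$, where $D=\mathrm{diag}(d_i)$ with $d_i=\sum_{j}B_{ij}$. The regularized adjacency matrix is $A_\tau:=A+(\tau/n)\mathbf{1}\mathbf{1}^{\mathsf T}$, where $\mathbf{1}$ is the all-ones vector (so $\tau/n$ is added to every entry), and $\mathbb{E}A_\tau=\mathbb{E}A+(\tau/n)\mathbf{1}\mathbf{1}^{\mathsf T}$. $\|\cdot\|$ denotes the spectral norm. *)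

theory Defs
  imports "HOL-Probability.Probability" "Jordan_Normal_Form.Matrix"
begin

text \<open>
  The number \<open>n\<close> of vertices is quantified inside the theorem (the constant must not depend
  on it), so matrices are those of \<^theory>\<open>Jordan_Normal_Form.Matrix\<close>, with explicit
  dimensions, and the vertices are \<open>0, \<dots>, n - 1\<close>.
\<close>

definition euclidean_norm :: "real vec \<Rightarrow> real" where
  "euclidean_norm v = L2_set (vec_index v) {..<dim_vec v}"

definition spectral_norm :: "real mat \<Rightarrow> real" where
  "spectral_norm B =
     (SUP v \<in> {v \<in> carrier_vec (dim_col B). euclidean_norm v \<le> 1}.
        euclidean_norm (mult_mat_vec B v))"

definition row_sum :: "real mat \<Rightarrow> nat \<Rightarrow> real" where
  "row_sum B i = (\<Sum>j<dim_col B. B $$ (i, j))"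

text \<open>
  This is meant for symmetric \<open>B\<close> with nonnegative entries and positive row sums; \<open>powr\<close>
  is then the true real power, and \<open>S\<close> below is the inverse square root of the degree matrix.
\<close>

definition laplacian :: "real mat \<Rightarrow> real mat" where
  "laplacian B =
     (let S = mat_diag (dim_row B) (\<lambda>i. row_sum B i powr (- 1 / 2))
      in 1\<^sub>m (dim_row B) - S * B * S)"

definition regularize :: "real \<Rightarrow> real mat \<Rightarrow> real mat" where
  "regularize \<tau> B =
     B + (\<tau> / real (dim_row B)) \<cdot>\<^sub>m Matrix.mat (dim_row B) (dim_row B) (\<lambda>_. 1)"

text \<open>
  The inhomogeneous Erdos-Renyi model, as the law of the random adjacency matrix: one
  independent Bernoulli variable for each pair \<open>i \<le> j\<close>, copied to both positions
  \<open>(i, j)\<close> and \<open>(j, i)\<close>. Loops are allowed, with probability \<open>P $$ (i, i)\<close>.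
\<close>

definition inhomogeneous_ER :: "nat \<Rightarrow> real mat \<Rightarrow> real mat pmf" where
  "inhomogeneous_ER n P =
     map_pmf
       (\<lambda>\<omega>. Matrix.mat n n (\<lambda>(i, j). of_bool (\<omega> (min i j, max i j))))
       (Pi_pmf {(i, j). i \<le> j \<and> j < n} False (\<lambda>ij. bernoulli_pmf (P $$ ij)))"

definition expected_mat :: "nat \<Rightarrow> real mat pmf \<Rightarrow> real mat" where
  "expected_mat n \<mu> =
     Matrix.mat n n (\<lambda>ij. measure_pmf.expectation \<mu> (\<lambda>A. A $$ ij))"

end

theory Submission
  imports Defs
begin

text \<open>
  Put \<open>\<Delta> = d + \<tau>\<close>. Since normalized adjacency matrices have norm at most 1, only the case \<open>\<tau> \<ge> r\<^sup>4\<close> matters.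
  The difference of the Laplacians splits into \<open>A - EA\<close>, normalized by the random degrees \<open>D\<^sub>i + \<tau>\<close>, and
  the error of replacing these degrees by their means, which is controlled in Frobenius norm by an
  exponential moment bound for \<open>\<Sum>\<^sub>i (D\<^sub>i - ED\<^sub>i)\<^sup>2\<close>.

  The first part is bounded by the method of Kahn and Szemeredi. The form \<open>\<Sum> (A - EA)\<^sub>i\<^sub>j x\<^sub>i y\<^sub>j\<close> is linear in
  each coordinate, so rescaled vectors can be rounded coordinatewise to integer vectors without
  decreasing it. The light pairs \<open>\<bar>x\<^sub>i y\<^sub>j\<bar> \<le> \<surd>\<Delta>\<close> are handled by Bernstein's inequality and a union bound over
  \<open>e\<^sup>O\<^sup>(\<^sup>n\<^sup>)\<close> integer vectors, the heavy pairs by level sets on a geometric scale and an upper bound for the edge counts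
  between all pairs of vertex sets. High-degree vertices need no separate treatment: the constraint
  \<open>\<Sum> (D\<^sub>i + \<tau>) x\<^sub>i\<^sup>2 \<le> 1\<close> already controls the heavy pairs with very unequal coordinates.
\<close>

section \<open>Sums of independent Bernoulli variables\<close>

text \<open>The obstacle is that sparse random graphs have vertices of degree far above
  \<open>\<Delta>\<close>. Normalizing \<open>A - EA\<close> by the random degrees rather than by
  their means damps each such vertex by its own degree: for a unit vector u, the vector with
  coordinates u i / sqrt (D i + \<tau>) satisfies the weighted constraint automatically. The price
  is the change of normalization in EA, and this second error dominates. With \<rho> = 1 + d /
  \<tau> the two parts are of order \<rho>^(1/2) / sqrt \<tau> and \<rho>^(5/2) / sqrt \<tau>, apart
  from factors of r.

  Large \<tau> is used twice: \<tau> >= 1 gives \<Delta> >= 1, and r^2 <= \<tau> gives (r + 4)^2 <=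
  25 \<Delta>, which keeps the random degrees of order \<Delta> in mean square. This is also why
  rounding is harmless: it adds a bounded amount to each squared coordinate, so the weighted
  constraint deteriorates only by a multiple of the total degree. Integrality in turn makes every
  nonzero coordinate at least 1, so that the levels need no lower cutoff.\<close>

text \<open>The coefficient 1 of the square on all of [-1, 1] keeps the Bernstein exponent free of
  constants. For negative x the reciprocal of the quadratic lower bound for exp at -x is compared
  with 1 + x + x^2.\<close>

lemma exp_le_quadratic:
  fixes x :: real
  assumes "\<bar>x\<bar> \<le> 1"
  shows "exp x \<le> 1 + x + x\<^sup>2"
proof (cases "x \<ge> 0")
  case True
  then show ?thesis using assms exp_bound by auto
next
  case False
  define y where "y = - x"
  have y: "0 \<le> y" "y \<le> 1" using False assms by (auto simp: y_def)
  have "exp x = 1 / exp y" by (simp add: y_def exp_minus inverse_eq_divide)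
  also have "\<dots> \<le> 1 / (1 + y + y\<^sup>2 / 2)"
    using exp_lower_Taylor_quadratic[of y] y by (intro divide_left_mono mult_pos_pos) (auto simp: add_pos_nonneg)
  also have "\<dots> \<le> 1 - y + y\<^sup>2"
  proof -
    have "(1 - y + y\<^sup>2) * (1 + y + y\<^sup>2 / 2) = 1 + y\<^sup>2 / 2 + y ^ 3 / 2 + y ^ 4 / 2"
      by (simp add: field_simps power2_eq_square power3_eq_cube power4_eq_xxxx)
    also have "\<dots> \<ge> 1" using y by auto
    finally show ?thesis using y
      by (subst pos_divide_le_eq) (auto simp: add_pos_nonneg)
  qed
  finally show ?thesis by (simp add: y_def)
qed

lemma pmf_markov:
  fixes X :: "'a \<Rightarrow> real"
  assumes "finite (set_pmf M)" "\<And>\<omega>. X \<omega> \<ge> 0" "c > 0"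
  shows "measure_pmf.prob M {\<omega>. c \<le> X \<omega>} \<le> measure_pmf.expectation M X / c"
proof -
  have "measure_pmf.prob M {\<omega>. c \<le> X \<omega>} = measure_pmf.prob M {\<omega> \<in> space M. c \<le> X \<omega>}"
    by simp
  also have "\<dots> \<le> measure_pmf.expectation M X / c"
    by (rule integral_Markov_inequality_measure[where A = "{}"])
       (auto intro!: integrable_measure_pmf_finite assms)
  finally show ?thesis .
qed

lemma pmf_markov_exp:
  fixes X :: "'a \<Rightarrow> real"
  assumes "finite (set_pmf M)"
  shows "measure_pmf.prob M {\<omega>. L \<le> X \<omega>} \<le> measure_pmf.expectation M (\<lambda>\<omega>. exp (X \<omega>)) / exp L"
  using pmf_markov[OF assms, of "\<lambda>\<omega>. exp (X \<omega>)" "exp L"] by simp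

section \<open>Exponential moments and tails of weighted Bernoulli sums\<close>

locale bernoulli_product =
  fixes E :: "'e set" and p :: "'e \<Rightarrow> real"
  assumes finite_E: "finite E"
    and p_nonneg: "e \<in> E \<Longrightarrow> 0 \<le> p e"
    and p_le_1: "e \<in> E \<Longrightarrow> p e \<le> 1"
begin

definition law :: "('e \<Rightarrow> bool) pmf" where
  "law = Pi_pmf E False (\<lambda>e. bernoulli_pmf (p e))"

lemma finite_set_law: "finite (set_pmf law)"
proof (rule finite_subset)
  show "set_pmf law \<subseteq> PiE_dflt E False (\<lambda>_. UNIV)"
    unfolding law_def by (subst set_Pi_pmf[OF finite_E]) (auto simp: PiE_dflt_def)
  show "finite (PiE_dflt E False (\<lambda>_. UNIV :: bool set))"
    by (intro finite_PiE_dflt finite_E) auto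
qed

lemma integrable_law [simp, intro]: "integrable (measure_pmf law) (f :: _ \<Rightarrow> real)"
  by (rule integrable_measure_pmf_finite[OF finite_set_law])

text \<open>1 + t <= exp t in each factor: a Bernoulli variable has at most the moment generating
  function of a Poisson variable with the same mean.\<close>

lemma mgf_le:
  "measure_pmf.expectation law (\<lambda>\<omega>. exp (\<Sum>e\<in>E. c e * of_bool (\<omega> e)))
     \<le> exp (\<Sum>e\<in>E. p e * (exp (c e) - 1))"
proof -
  have "measure_pmf.expectation law (\<lambda>\<omega>. exp (\<Sum>e\<in>E. c e * of_bool (\<omega> e)))
      = measure_pmf.expectation law (\<lambda>\<omega>. \<Prod>e\<in>E. exp (c e * of_bool (\<omega> e)))"
    by (simp only: exp_sum[OF finite_E])
  also have "\<dots> = (\<Prod>e\<in>E. measure_pmf.expectation (bernoulli_pmf (p e)) (\<lambda>b. exp (c e * of_bool b)))"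
    unfolding law_def
    by (rule expectation_prod_Pi_pmf) (auto simp: finite_E intro!: integrable_measure_pmf_finite)
  also have "\<dots> \<le> (\<Prod>e\<in>E. exp (p e * (exp (c e) - 1)))"
  proof (rule prod_mono, safe)
    fix e assume e: "e \<in> E"
    note p = p_nonneg[OF e] p_le_1[OF e]
    have *: "measure_pmf.expectation (bernoulli_pmf (p e)) (\<lambda>b. exp (c e * of_bool b))
        = 1 + p e * (exp (c e) - 1)"
      using p by (simp add: algebra_simps)
    show "measure_pmf.expectation (bernoulli_pmf (p e)) (\<lambda>b. exp (c e * of_bool b))
        \<le> exp (p e * (exp (c e) - 1))"
      unfolding * by (rule exp_ge_add_one_self)
    show "0 \<le> measure_pmf.expectation (bernoulli_pmf (p e)) (\<lambda>b. exp (c e * of_bool b))"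
      using p by simp
  qed
  also have "\<dots> = exp (\<Sum>e\<in>E. p e * (exp (c e) - 1))" by (simp add: exp_sum finite_E)
  finally show ?thesis .
qed

text \<open>Centering removes the linear term of exp (c e) - 1, and what remains is at most
  quadratic. The sum of p e * (c e)^2 plays the role of the variance.\<close>

lemma centered_mgf_le:
  assumes "\<And>e. e \<in> E \<Longrightarrow> \<bar>c e\<bar> \<le> 1"
  shows "measure_pmf.expectation law (\<lambda>\<omega>. exp (\<Sum>e\<in>E. c e * (of_bool (\<omega> e) - p e)))
     \<le> exp (\<Sum>e\<in>E. p e * (c e)\<^sup>2)"
proof -
  have "measure_pmf.expectation law (\<lambda>\<omega>. exp (\<Sum>e\<in>E. c e * (of_bool (\<omega> e) - p e)))
     = measure_pmf.expectation law (\<lambda>\<omega>. exp (\<Sum>e\<in>E. c e * of_bool (\<omega> e)) * exp (- (\<Sum>e\<in>E. c e * p e)))"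
    by (simp add: right_diff_distrib sum_subtractf flip: exp_add)
  also have "\<dots> = measure_pmf.expectation law (\<lambda>\<omega>. exp (\<Sum>e\<in>E. c e * of_bool (\<omega> e))) * exp (- (\<Sum>e\<in>E. c e * p e))"
    by simp
  also have "\<dots> \<le> exp (\<Sum>e\<in>E. p e * (exp (c e) - 1)) * exp (- (\<Sum>e\<in>E. c e * p e))"
    by (intro mult_right_mono mgf_le) auto
  also have "\<dots> = exp (\<Sum>e\<in>E. p e * (exp (c e) - 1 - c e))"
    by (simp add: sum_subtractf sum.distrib algebra_simps flip: exp_add)
  also have "\<dots> \<le> exp (\<Sum>e\<in>E. p e * (c e)\<^sup>2)"
    unfolding exp_le_cancel_iff
  proof (intro sum_mono mult_left_mono)
    fix e assume e: "e \<in> E"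
    show "exp (c e) - 1 - c e \<le> (c e)\<^sup>2" using exp_le_quadratic[OF assms[OF e]] by simp
  qed (use p_nonneg in auto)
  finally show ?thesis .
qed

text \<open>The free parameter of Chernoff's method is absorbed in the weights, so nothing is
  optimized here; the scale of \<open>c\<close> is chosen at each use.\<close>

lemma chernoff:
  "measure_pmf.prob law {\<omega>. L \<le> (\<Sum>e\<in>E. c e * of_bool (\<omega> e))}
     \<le> exp ((\<Sum>e\<in>E. p e * (exp (c e) - 1)) - L)"
proof -
  have "measure_pmf.prob law {\<omega>. L \<le> (\<Sum>e\<in>E. c e * of_bool (\<omega> e))}
      \<le> measure_pmf.expectation law (\<lambda>\<omega>. exp (\<Sum>e\<in>E. c e * of_bool (\<omega> e))) / exp L"
    by (rule pmf_markov_exp[OF finite_set_law])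
  also have "\<dots> \<le> exp (\<Sum>e\<in>E. p e * (exp (c e) - 1)) / exp L"
    by (intro divide_right_mono mgf_le) auto
  finally show ?thesis by (simp add: exp_diff)
qed

lemma bernstein:
  assumes "\<And>e. e \<in> E \<Longrightarrow> \<bar>c e\<bar> \<le> 1"
  shows "measure_pmf.prob law {\<omega>. L \<le> (\<Sum>e\<in>E. c e * (of_bool (\<omega> e) - p e))}
     \<le> exp ((\<Sum>e\<in>E. p e * (c e)\<^sup>2) - L)"
proof -
  have "measure_pmf.prob law {\<omega>. L \<le> (\<Sum>e\<in>E. c e * (of_bool (\<omega> e) - p e))}
      \<le> measure_pmf.expectation law (\<lambda>\<omega>. exp (\<Sum>e\<in>E. c e * (of_bool (\<omega> e) - p e))) / exp L"
    by (rule pmf_markov_exp[OF finite_set_law])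
  also have "\<dots> \<le> exp (\<Sum>e\<in>E. p e * (c e)\<^sup>2) / exp L"
    by (intro divide_right_mono centered_mgf_le assms) auto
  finally show ?thesis by (simp add: exp_diff)
qed

end

section \<open>Heavy pairs\<close>

text \<open>This is k ln (e n / k), the exponent in the usual bound (e n / k)^k for the number of
  k-element subsets. The factor k makes it vanish at k = 0.\<close>

definition subset_entropy :: "nat \<Rightarrow> nat \<Rightarrow> real" where
  "subset_entropy n k = real k * (1 + ln (real n / real k))"

text \<open>The entropy is concave in k; up to an extra k on the right, this is its tangent at k = n
  / z. It replaces the logarithm of an unknown size by that of a chosen z, so that entropies of
  different levels can be added.\<close>

lemma subset_entropy_le:
  assumes "n > 0" "z > 0"
  shows "subset_entropy n k \<le> real k * (1 + ln z) + real n / z"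
proof (cases "k = 0")
  case True
  then show ?thesis using assms by (simp add: subset_entropy_def)
next
  case False
  have "ln (real n / real k) = ln (z * (real n / (real k * z)))"
    using assms by (simp add: field_simps)
  also have "\<dots> = ln z + ln (real n / (real k * z))"
    using assms False by (intro ln_mult_pos) auto
  also have "\<dots> \<le> ln z + (real n / (real k * z) - 1)"
    using assms False by (intro add_left_mono ln_le_minus_one) auto
  finally have "subset_entropy n k \<le> real k * (1 + (ln z + (real n / (real k * z) - 1)))"
    unfolding subset_entropy_def by (intro mult_left_mono add_left_mono) auto
  also have "\<dots> = real k * (1 + ln z) + real n / z - real k"
    using assms False by (simp add: field_simps)
  finally show ?thesis by simp
qed

lemma sum_power2_le_sqrt:
  assumes "finite T" "\<And>t. t \<in> T \<Longrightarrow> 4 ^ t \<le> R" "R \<ge> 0"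
  shows "(\<Sum>t\<in>T. 2 ^ t) \<le> 2 * sqrt R"
proof (cases "T = {}")
  case False
  define m where "m = Max T"
  have m: "m \<in> T" "T \<subseteq> {..<Suc m}" using assms False by (auto simp: m_def less_Suc_eq_le)
  have "(\<Sum>t\<in>T. 2 ^ t :: real) \<le> (\<Sum>t<Suc m. 2 ^ t)" using m by (intro sum_mono2) auto
  also have "\<dots> = 2 ^ Suc m - 1" by (subst geometric_sum) auto
  also have "\<dots> \<le> 2 * 2 ^ m" by simp
  also have "(2::real) ^ m = sqrt (4 ^ m)"
    by (rule real_sqrt_unique[symmetric]) (auto simp: power2_eq_square simp flip: power_mult_distrib)
  also have "\<dots> \<le> sqrt R" using assms m by simp
  finally show ?thesis by simp
qed (use assms in auto)

lemma ln_le_two_sqrt: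
  assumes "v > 0"
  shows "1 + ln v \<le> 2 * sqrt v"
proof -
  have "ln v = 2 * ln (sqrt v)" using assms by (simp add: ln_sqrt)
  also have "\<dots> \<le> 2 * (sqrt v - 1)" using assms by (intro mult_left_mono ln_le_minus_one) auto
  finally show ?thesis by simp
qed

lemma one_le_ln_4: "(1::real) \<le> ln 4"
proof -
  have "exp (1::real) \<le> 4" using exp_le by simp
  then show ?thesis by (subst ln_ge_iff) auto
qed

text \<open>The gain is the divisor 1 + s. Without it the sum is geometric in t and of order q *
  4^s. At the top values of t the logarithm is of order 1 + s; for smaller t it shrinks, but there
  4^t is far below its maximum.\<close>

lemma sum_level_weights:
  fixes q :: real
  assumes T: "finite T" and q: "q > 0"
    and up: "\<And>t. t \<in> T \<Longrightarrow> 4 ^ t < q * 4 ^ (s + 1)"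
    and low: "\<And>t. t \<in> T \<Longrightarrow> q < 4 ^ (s + t + 2)"
  shows "(\<Sum>t\<in>T. 4 ^ t / (1 + ln (4 ^ (s + t + 2) / q))) \<le> 16 * q * 4 ^ s / (1 + real s)"
proof -
  define R where "R = q * 4 ^ (s + 1)"
  have R: "R > 0" using q by (simp add: R_def)
  have "(\<Sum>t\<in>T. 4 ^ t / (1 + ln (4 ^ (s + t + 2) / q))) \<le> (\<Sum>t\<in>T. 2 * sqrt R / (1 + real s) * 2 ^ t)"
  proof (rule sum_mono)
    fix t assume t: "t \<in> T"
    define \<theta> where "\<theta> = 1 + ln (4 ^ (s + t + 2) / q)"
    define v where "v = R / 4 ^ t"
    have \<theta>: "\<theta> \<ge> 1" using low[OF t] q by (simp add: \<theta>_def)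
    have v: "v > 1" using up[OF t] by (simp add: v_def R_def)
    \<comment> \<open>As t varies, \<open>\<theta>\<close> grows exactly as fast as
      \<open>ln v\<close> decreases, so the sum depends on s only. A small \<open>\<theta>\<close>
      therefore forces a large \<open>v\<close>.\<close>
    have "\<theta> + ln v = 1 + ln (4 ^ (s + t + 2) / q * v)"
      using v q by (subst ln_mult_pos) (auto simp: \<theta>_def)
    also have "4 ^ (s + t + 2) / q * v = 4 ^ (2 * s + 3)"
      using q by (simp add: v_def R_def field_simps power_add power_mult power2_eq_square mult_2
          flip: power_mult_distrib)
    also have "ln (4 ^ (2 * s + 3)) = real (2 * s + 3) * ln (4::real)" by (rule ln_realpow)
    finally have "\<theta> + ln v = 1 + real (2 * s + 3) * ln 4" .
    moreover have "real (2 * s + 3) * 1 \<le> real (2 * s + 3) * ln 4"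
      by (intro mult_left_mono one_le_ln_4) simp
    moreover have "real s \<le> real (2 * s + 3) * 1" by simp
    ultimately have "1 + real s \<le> \<theta> + ln v" by linarith
    also have "\<dots> \<le> \<theta> * (1 + ln v)"
      using \<theta> v mult_right_mono[of 1 \<theta> "ln v"] by (simp add: algebra_simps)
    also have "\<dots> \<le> \<theta> * (2 * sqrt v)" using \<theta> v by (intro mult_left_mono ln_le_two_sqrt) auto
    finally have *: "1 + real s \<le> \<theta> * (2 * sqrt v)" .
    have "(4::real) ^ t = sqrt (4 ^ t) * sqrt (4 ^ t)" by simp
    also have "sqrt (4 ^ t) = (2::real) ^ t"
      by (rule real_sqrt_unique) (auto simp: power2_eq_square simp flip: power_mult_distrib)
    finally have 4: "(4::real) ^ t = 2 ^ t * 2 ^ t" .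
    have "sqrt v * 2 ^ t = sqrt R" 
      unfolding v_def 4 real_sqrt_divide by (simp add: real_sqrt_mult)
    then have **: "sqrt R * 2 ^ t = sqrt v * 4 ^ t" unfolding 4 by simp
    have "4 ^ t * (1 + real s) \<le> 4 ^ t * (\<theta> * (2 * sqrt v))"
      using * by (intro mult_left_mono) auto
    then have "4 ^ t / \<theta> \<le> 2 * (sqrt v * 4 ^ t) / (1 + real s)" using \<theta> by (simp add: field_simps)
    then show "4 ^ t / (1 + ln (4 ^ (s + t + 2) / q)) \<le> 2 * sqrt R / (1 + real s) * 2 ^ t"
      unfolding \<theta>_def by (simp flip: **)
  qed
  also have "\<dots> = 2 * sqrt R / (1 + real s) * (\<Sum>t\<in>T. 2 ^ t)" by (rule sum_distrib_left[symmetric])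
  also have "\<dots> \<le> 2 * sqrt R / (1 + real s) * (2 * sqrt R)"
    using R up by (intro mult_left_mono sum_power2_le_sqrt T) (auto simp: R_def less_imp_le)
  also have "\<dots> = 4 * R / (1 + real s)" using R by simp
  finally show ?thesis by (simp add: R_def field_simps)
qed

text \<open>The tangent bound is used with z = 32^s: its logarithm is of order 1 + s and cancels
  against the divisor, while 32 > 16 leaves the convergent series of (16 / 32)^s. The total is 4 *
  4n + 2n.\<close>

lemma sum_level_entropies:
  assumes S: "finite S" and n: "n > 0"
    and m: "(\<Sum>s\<in>S. 16 ^ s * real (m s)) \<le> 4 * real n"
  shows "(\<Sum>s\<in>S. 16 ^ s * subset_entropy n (m s) / (1 + real s)) \<le> 18 * real n"
proof -
  have "(\<Sum>s\<in>S. 16 ^ s * subset_entropy n (m s) / (1 + real s))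
      \<le> (\<Sum>s\<in>S. 4 * (16 ^ s * real (m s)) + real n * (1 / 2) ^ s)"
  proof (rule sum_mono)
    fix s
    have "(32::real) \<le> (5 / 2) ^ 4" by (simp add: power4_eq_xxxx)
    also have "\<dots> \<le> exp 1 ^ 4"
      using exp_lower_Taylor_quadratic[of "1::real"] by (intro power_mono) auto
    also have "\<dots> = exp (4::real)" by (simp flip: exp_of_nat_mult)
    finally have l: "ln (32::real) \<le> 4" using ln_le_cancel_iff[of 32 "exp 4"] by simp
    have "subset_entropy n (m s) \<le> real (m s) * (1 + ln (32 ^ s)) + real n / 32 ^ s"
      by (rule subset_entropy_le) (use n in auto)
    also have "\<dots> \<le> real (m s) * (4 * (1 + real s)) + real n / 32 ^ s * (1 + real s)"
    proof (intro add_mono mult_left_mono)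
      show "1 + ln (32 ^ s) \<le> 4 * (1 + real s)"
        using mult_left_mono[OF l, of "real s"] by (simp add: ln_realpow)
      show "real n / 32 ^ s \<le> real n / 32 ^ s * (1 + real s)"
        using mult_left_mono[of 1 "1 + real s" "real n / 32 ^ s"] by simp
    qed auto
    finally have "subset_entropy n (m s) / (1 + real s) \<le> 4 * real (m s) + real n / 32 ^ s"
      by (simp add: field_simps)
    from mult_left_mono[OF this, of "16 ^ s"]
    have "16 ^ s * subset_entropy n (m s) / (1 + real s)
        \<le> 4 * (16 ^ s * real (m s)) + real n * (16 ^ s / 32 ^ s)" by (simp add: algebra_simps)
    also have "(16::real) ^ s / 32 ^ s = (1 / 2) ^ s" by (simp flip: power_divide)
    finally show "16 ^ s * subset_entropy n (m s) / (1 + real s)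
        \<le> 4 * (16 ^ s * real (m s)) + real n * (1 / 2) ^ s" .
  qed
  also have "\<dots> = 4 * (\<Sum>s\<in>S. 16 ^ s * real (m s)) + real n * (\<Sum>s\<in>S. (1 / 2) ^ s)"
    by (simp add: sum.distrib sum_distrib_left)
  also have "(\<Sum>s\<in>S. (1 / 2 :: real) ^ s) \<le> (\<Sum>s. (1 / 2) ^ s)"
    by (rule sum_le_suminf[OF summable_geometric S]) auto
  also have "(\<Sum>s. (1 / 2 :: real) ^ s) = 2" by (subst suminf_geometric) auto
  finally show ?thesis using m n by simp
qed

text \<open>Summing over t first leaves the weight 256 * q * 16^s / (1 + s): one factor 4^s comes
  from 4^(s + t + 2), the other from \<open>sum_level_weights\<close>. Only then are the entropies
  of the levels s added, and 4608 = 256 * 18.\<close>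

lemma sum_balanced_entropies:
  fixes q :: real
  assumes Q: "finite Q" and n: "n > 0" and q: "q > 0"
    and up: "\<And>s t. (s, t) \<in> Q \<Longrightarrow> 4 ^ t < q * 4 ^ (s + 1)"
    and low: "\<And>s t. (s, t) \<in> Q \<Longrightarrow> q < 4 ^ (s + t + 2)"
    and m: "(\<Sum>s\<in>fst ` Q. 16 ^ s * real (m s)) \<le> 4 * real n"
    and m0: "\<And>s. subset_entropy n (m s) \<ge> 0"
  shows "(\<Sum>(s, t)\<in>Q. 4 ^ (s + t + 2) / (1 + ln (4 ^ (s + t + 2) / q)) * subset_entropy n (m s))
    \<le> 4608 * q * real n"
proof -
  define T where "T s = {t. (s, t) \<in> Q}" for s
  have T: "finite (T s)" for s
    by (rule finite_subset[of _ "snd ` Q"]) (use Q in \<open>force simp: T_def\<close>)+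
  have QT: "Q = Sigma (fst ` Q) T" by (force simp: T_def)
  have "(\<Sum>(s, t)\<in>Q. 4 ^ (s + t + 2) / (1 + ln (4 ^ (s + t + 2) / q)) * subset_entropy n (m s))
    = (\<Sum>s\<in>fst ` Q. \<Sum>t\<in>T s. 4 ^ (s + t + 2) / (1 + ln (4 ^ (s + t + 2) / q)) * subset_entropy n (m s))"
    by (subst QT, rule sum.Sigma[symmetric]) (use Q T in auto)
  also have "\<dots> = (\<Sum>s\<in>fst ` Q. 16 * 4 ^ s * subset_entropy n (m s) *
      (\<Sum>t\<in>T s. 4 ^ t / (1 + ln (4 ^ (s + t + 2) / q))))"
    unfolding sum_distrib_left by (intro sum.cong refl) (simp add: power_add field_simps)
  also have "\<dots> \<le> (\<Sum>s\<in>fst ` Q. 16 * 4 ^ s * subset_entropy n (m s) * (16 * q * 4 ^ s / (1 + real s)))"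
    by (intro sum_mono mult_left_mono sum_level_weights T q up low mult_nonneg_nonneg m0)
       (auto simp: T_def)
  also have "\<dots> = 256 * q * (\<Sum>s\<in>fst ` Q. 16 ^ s * subset_entropy n (m s) / (1 + real s))"
  proof -
    have "(16::real) ^ s = 4 ^ s * 4 ^ s" for s by (simp flip: power_mult_distrib)
    then show ?thesis unfolding sum_distrib_left by (intro sum.cong refl) (simp add: field_simps)
  qed
  also have "\<dots> \<le> 256 * q * (18 * real n)"
    using q by (intro mult_left_mono sum_level_entropies m n) (use Q in auto)
  finally show ?thesis by simp
qed

section \<open>Level sets of integer vectors and balanced heavy pairs\<close>

definition level :: "real \<Rightarrow> nat" where
  "level x = nat \<lfloor>log 4 x\<rfloor>"

lemma level:
  assumes "x \<ge> 1"
  shows "4 ^ level x \<le> x" "x < 4 ^ (level x + 1)"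
proof -
  have l: "log 4 x \<ge> 0" using assms by simp
  have "real (level x) \<le> log 4 x" "log 4 x < real (level x + 1)"
    using l unfolding level_def by linarith+
  then have "4 powr real (level x) \<le> x" "x < 4 powr real (level x + 1)"
    using assms by (simp_all add: powr_le_iff less_powr_iff)
  then show "4 ^ level x \<le> x" "x < 4 ^ (level x + 1)" by (simp_all add: powr_realpow[symmetric] powr_add)
qed


lemma subset_entropy_ge:
  assumes "k \<le> n"
  shows "real k \<le> subset_entropy n k"
proof (cases "k = 0")
  case False
  then have "real n / real k \<ge> 1" using assms by simp
  then show ?thesis
    unfolding subset_entropy_def using mult_left_mono[of 1 "1 + ln (real n / real k)" "real k"] by simp
qed (simp add: subset_entropy_def)

text \<open>For integral \<open>a\<close> these are the nonzero coordinates with 4^s <= |a i| < 4^(s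
  + 1), because a nonzero integer has absolute value at least 1. Zero coordinates never belong to a
  heavy pair.\<close>

definition level_set :: "nat \<Rightarrow> (nat \<Rightarrow> real) \<Rightarrow> nat \<Rightarrow> nat set" where
  "level_set n a s = {i \<in> {..<n}. a i \<noteq> 0 \<and> level \<bar>a i\<bar> = s}"

lemma level_set_subset: "level_set n a s \<subseteq> {..<n}"
  by (auto simp: level_set_def)

lemma finite_level_set [simp]: "finite (level_set n a s)"
  by (rule finite_subset[OF level_set_subset]) simp

lemma card_level_set_le: "card (level_set n a s) \<le> n"
  using card_mono[OF _ level_set_subset[of n a s]] by simp

lemma sum_level_sets:
  assumes "finite S" "\<And>i. i < n \<Longrightarrow> a i \<in> \<int>"
  shows "(\<Sum>s\<in>S. 16 ^ s * real (card (level_set n a s))) \<le> (\<Sum>i<n. (a i)\<^sup>2)"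
proof -
  have "(\<Sum>s\<in>S. 16 ^ s * real (card (level_set n a s))) = (\<Sum>s\<in>S. \<Sum>i\<in>level_set n a s. 16 ^ s)"
    by (simp add: mult.commute)
  also have "\<dots> \<le> (\<Sum>s\<in>S. \<Sum>i\<in>level_set n a s. (a i)\<^sup>2)"
  proof (intro sum_mono)
    fix s i assume "i \<in> level_set n a s"
    then have i: "i < n" "a i \<noteq> 0" "level \<bar>a i\<bar> = s" by (auto simp: level_set_def)
    have "(4::real) ^ s \<le> \<bar>a i\<bar>"
      using level(1)[OF Ints_nonzero_abs_ge1[OF assms(2)[OF i(1)] i(2)]] i by simp
    then have "((4::real) ^ s)\<^sup>2 \<le> \<bar>a i\<bar>\<^sup>2" by (intro power_mono) auto
    then show "16 ^ s \<le> (a i)\<^sup>2" by (simp add: power2_eq_square flip: power_mult_distrib)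
  qed
  also have "\<dots> = (\<Sum>i\<in>(\<Union>s\<in>S. level_set n a s). (a i)\<^sup>2)"
    by (rule sum.UNION_disjoint[symmetric]) (use assms in \<open>auto simp: level_set_def\<close>)
  also have "\<dots> \<le> (\<Sum>i<n. (a i)\<^sup>2)"
    by (rule sum_mono2) (auto simp: level_set_def)
  finally show ?thesis .
qed

text \<open>The free exponent in \<open>discrepancy\<close> replaces the usual alternative between
  edge counts comparable to the mean and edge counts controlled by entropy. One exponent is chosen
  for each pair of levels; the mean terms then factor into the two norms, and the entropy terms fall
  under \<open>sum_balanced_entropies\<close>, whose bounds on 4^t are what balance
  provides.\<close>

lemma balanced_heavy_sum:
  fixes u :: "nat \<times> nat \<Rightarrow> real" and a b :: "nat \<Rightarrow> real" and q K :: real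
  assumes n: "n > 0" and q: "q \<ge> 1" and K: "K \<ge> 0"
    and E: "E \<subseteq> {..<n} \<times> {..<n}" and u: "\<And>e. e \<in> E \<Longrightarrow> u e \<ge> 0"
    and aZ: "\<And>i. i < n \<Longrightarrow> a i \<in> \<int>" and bZ: "\<And>i. i < n \<Longrightarrow> b i \<in> \<int>"
    and a: "(\<Sum>i<n. (a i)\<^sup>2) \<le> 4 * real n" and b: "(\<Sum>i<n. (b i)\<^sup>2) \<le> 4 * real n"
    and discrepancy: "\<And>I J \<theta>. I \<subseteq> {..<n} \<Longrightarrow> J \<subseteq> {..<n} \<Longrightarrow> \<theta> \<ge> 0 \<Longrightarrow>
      \<theta> * (\<Sum>e\<in>E \<inter> I \<times> J. u e) \<le> exp \<theta> * (real (card I) * real (card J) * q\<^sup>2 / real n)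
         + K * (subset_entropy n (card I) + subset_entropy n (card J))"
  shows "(\<Sum>e | e \<in> E \<and> q < \<bar>a (fst e) * b (snd e)\<bar> \<and> \<bar>b (snd e)\<bar> < q * \<bar>a (fst e)\<bar>
            \<and> \<bar>a (fst e)\<bar> < q * \<bar>b (snd e)\<bar>. u e * \<bar>a (fst e) * b (snd e)\<bar>)
    \<le> (12288 + 9216 * K) * q * real n"
proof -
  define H where "H = {e. e \<in> E \<and> q < \<bar>a (fst e) * b (snd e)\<bar> \<and> \<bar>b (snd e)\<bar> < q * \<bar>a (fst e)\<bar>
            \<and> \<bar>a (fst e)\<bar> < q * \<bar>b (snd e)\<bar>}"
  define lev where "lev e = (level \<bar>a (fst e)\<bar>, level \<bar>b (snd e)\<bar>)" for e
  define Q where "Q = lev ` H"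
  define m where "m s = card (level_set n a s)" for s
  define k where "k t = card (level_set n b t)" for t
  define w where "w s t = 4 ^ (s + t + 2) / (1 + ln (4 ^ (s + t + 2) / q))" for s t
  have fin_E: "finite E" using E by (rule finite_subset) auto
  have fin_H: "finite H" unfolding H_def using fin_E by simp
  have fin_Q: "finite Q" unfolding Q_def using fin_H by simp
  have H_levels: "i < n" "j < n" "i \<in> level_set n a (level \<bar>a i\<bar>)" "j \<in> level_set n b (level \<bar>b j\<bar>)"
      "4 ^ level \<bar>a i\<bar> \<le> \<bar>a i\<bar>" "\<bar>a i\<bar> < 4 * 4 ^ level \<bar>a i\<bar>"
      "4 ^ level \<bar>b j\<bar> \<le> \<bar>b j\<bar>" "\<bar>b j\<bar> < 4 * 4 ^ level \<bar>b j\<bar>"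
      "q < \<bar>a i\<bar> * \<bar>b j\<bar>" "\<bar>b j\<bar> < q * \<bar>a i\<bar>" "\<bar>a i\<bar> < q * \<bar>b j\<bar>"
    if "(i, j) \<in> H" for i j
  proof -
    show ij: "i < n" "j < n" using that E by (auto simp: H_def)
    have nz: "a i \<noteq> 0" "b j \<noteq> 0" using that q by (auto simp: H_def)
    show "i \<in> level_set n a (level \<bar>a i\<bar>)" "j \<in> level_set n b (level \<bar>b j\<bar>)"
      using ij nz by (auto simp: level_set_def)
    have ge1: "1 \<le> \<bar>a i\<bar>" "1 \<le> \<bar>b j\<bar>"
      using Ints_nonzero_abs_ge1 aZ[OF ij(1)] bZ[OF ij(2)] nz by blast+
    show "4 ^ level \<bar>a i\<bar> \<le> \<bar>a i\<bar>" "\<bar>a i\<bar> < 4 * 4 ^ level \<bar>a i\<bar>"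
      "4 ^ level \<bar>b j\<bar> \<le> \<bar>b j\<bar>" "\<bar>b j\<bar> < 4 * 4 ^ level \<bar>b j\<bar>"
      using level[OF ge1(1)] level[OF ge1(2)] by auto
    show "q < \<bar>a i\<bar> * \<bar>b j\<bar>" "\<bar>b j\<bar> < q * \<bar>a i\<bar>" "\<bar>a i\<bar> < q * \<bar>b j\<bar>"
      using that by (auto simp: H_def abs_mult)
  qed
  have Q_low: "q < 4 ^ (s + t + 2)" and Q_up: "4 ^ t < q * 4 ^ (s + 1)" and Q_up': "4 ^ s < q * 4 ^ (t + 1)"
    if st: "(s, t) \<in> Q" for s t
  proof -
    obtain i j where ij: "(i, j) \<in> H" "s = level \<bar>a i\<bar>" "t = level \<bar>b j\<bar>"
      using st by (auto simp: Q_def lev_def)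
    note l = H_levels[OF ij(1), folded ij(2,3)]
    have "\<bar>a i\<bar> * \<bar>b j\<bar> \<le> (4 * 4 ^ s) * (4 * 4 ^ t)"
      using l by (intro mult_mono) auto
    then show "q < 4 ^ (s + t + 2)" using l(9) by (simp add: power_add mult_ac)
    have "q * \<bar>a i\<bar> \<le> q * (4 * 4 ^ s)" "q * \<bar>b j\<bar> \<le> q * (4 * 4 ^ t)"
      using l q by (auto intro!: mult_left_mono)
    then show "4 ^ t < q * 4 ^ (s + 1)" "4 ^ s < q * 4 ^ (t + 1)" using l by auto
  qed
  have entropy_nonneg: "subset_entropy n (m s) \<ge> 0" "subset_entropy n (k s) \<ge> 0" for s
    using subset_entropy_ge[OF card_level_set_le[of n a s]] subset_entropy_ge[OF card_level_set_le[of n b s]]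
    unfolding m_def k_def by linarith+
  have cell: "(\<Sum>e | e \<in> H \<and> lev e = (s, t). u e * \<bar>a (fst e) * b (snd e)\<bar>)
     \<le> 768 * q / real n * ((16 ^ s * real (m s)) * (16 ^ t * real (k t)))
       + (K * (w s t * subset_entropy n (m s)) + K * (w t s * subset_entropy n (k t)))"
    if st: "(s, t) \<in> Q" for s t
  proof -
    define e0 where "e0 = (\<Sum>e\<in>E \<inter> level_set n a s \<times> level_set n b t. u e)"
    define x where "x = 4 ^ (s + t + 2) / q"
    \<comment> \<open>Now exp \<theta> = e * x, so the mean term carries 4^(s + t + 2) twice and
      becomes a product of 16^s and 16^t with the sizes of the level sets; its constant is 768 = 3 *
      4^4. Heaviness gives x > 1, hence \<theta> >= 1.\<close>
    define \<theta> where "\<theta> = 1 + ln x"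
    have x: "x > 1" using Q_low[OF st] q by (simp add: x_def)
    have \<theta>: "\<theta> \<ge> 1" using x by (simp add: \<theta>_def)
    \<comment> \<open>The weight is symmetric. Pairing the second level set with
      \<open>w t s\<close> gives its entropy sum the shape of \<open>sum_balanced_entropies\<close>
      after the two vectors are exchanged.\<close>
    have w: "w s t = 4 ^ (s + t + 2) / \<theta>" "w t s = 4 ^ (s + t + 2) / \<theta>"
      by (simp_all add: w_def \<theta>_def x_def add.commute)
    have "(\<Sum>e | e \<in> H \<and> lev e = (s, t). u e * \<bar>a (fst e) * b (snd e)\<bar>)
        \<le> (\<Sum>e | e \<in> H \<and> lev e = (s, t). u e * 4 ^ (s + t + 2))"
    proof (rule sum_mono)
      fix e assume e: "e \<in> {e. e \<in> H \<and> lev e = (s, t)}"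
      obtain i j where ij: "e = (i, j)" by force
      have H: "(i, j) \<in> H" and st: "s = level \<bar>a i\<bar>" "t = level \<bar>b j\<bar>" using e ij by (auto simp: lev_def)
      note l = H_levels[OF H, folded st]
      have "\<bar>a i\<bar> * \<bar>b j\<bar> \<le> (4 * 4 ^ s) * (4 * 4 ^ t)"
        using l by (intro mult_mono) auto
      also have "\<dots> = 4 ^ (s + t + 2)" by (simp add: power_add)
      finally show "u e * \<bar>a (fst e) * b (snd e)\<bar> \<le> u e * 4 ^ (s + t + 2)"
        using H u[of e] unfolding ij by (intro mult_left_mono) (auto simp: abs_mult H_def)
    qed
    also have "\<dots> \<le> (\<Sum>e\<in>E \<inter> level_set n a s \<times> level_set n b t. u e * 4 ^ (s + t + 2))"
    proof (rule sum_mono2)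
      show "{e. e \<in> H \<and> lev e = (s, t)} \<subseteq> E \<inter> level_set n a s \<times> level_set n b t"
        using H_levels(3,4) by (auto simp: lev_def) (auto simp: H_def)
    qed (use fin_E u in auto)
    also have "\<dots> = w s t * (\<theta> * e0)"
      using \<theta> by (simp add: w e0_def sum_distrib_right[symmetric])
    also have "\<dots> \<le> w s t * (exp \<theta> * (real (m s) * real (k t) * q\<^sup>2 / real n)
         + K * (subset_entropy n (m s) + subset_entropy n (k t)))"
      unfolding e0_def m_def k_def using \<theta>
      by (intro mult_left_mono discrepancy level_set_subset) (auto simp: w)
    also have "\<dots> = w s t * (exp \<theta> * (real (m s) * real (k t) * q\<^sup>2 / real n))
         + (K * (w s t * subset_entropy n (m s)) + K * (w t s * subset_entropy n (k t)))"
      unfolding w by (simp add: algebra_simps)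
    also have "w s t * (exp \<theta> * (real (m s) * real (k t) * q\<^sup>2 / real n))
        \<le> 4 ^ (s + t + 2) * ((3 * x) * (real (m s) * real (k t) * q\<^sup>2 / real n))"
    proof (intro mult_mono)
      show "w s t \<le> 4 ^ (s + t + 2)" using \<theta> unfolding w by (simp add: pos_divide_le_eq)
      have "exp \<theta> = exp 1 * x" using x by (simp add: \<theta>_def exp_add)
      also have "\<dots> \<le> 3 * x" using exp_le x by (intro mult_right_mono) auto
      finally show "exp \<theta> \<le> 3 * x" .
    qed (use x in auto)
    also have "\<dots> = 768 * q / real n * ((16 ^ s * real (m s)) * (16 ^ t * real (k t)))"
    proof -
      have "(16::real) ^ s = 4 ^ s * 4 ^ s" for s by (simp flip: power_mult_distrib)
      then show ?thesis using q n by (simp add: x_def power_add field_simps power2_eq_square)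
    qed
    finally show ?thesis by simp
  qed
  have sum_m: "(\<Sum>s\<in>S. 16 ^ s * real (m s)) \<le> 4 * real n" if "finite S" for S
    unfolding m_def using sum_level_sets[where n = n and a = a, OF that aZ] a by linarith
  have sum_k: "(\<Sum>s\<in>S. 16 ^ s * real (k s)) \<le> 4 * real n" if "finite S" for S
    unfolding k_def using sum_level_sets[where n = n and a = b, OF that bZ] b by linarith
  have fin: "finite (fst ` Q)" "finite (snd ` Q)" using fin_Q by auto
  have main: "(\<Sum>(s, t)\<in>Q. (16 ^ s * real (m s)) * (16 ^ t * real (k t))) \<le> 16 * (real n)\<^sup>2"
  proof -
    have "(\<Sum>(s, t)\<in>Q. (16 ^ s * real (m s)) * (16 ^ t * real (k t)))
      \<le> (\<Sum>(s, t)\<in>fst ` Q \<times> snd ` Q. (16 ^ s * real (m s)) * (16 ^ t * real (k t)))"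
      by (rule sum_mono2) (use fin in \<open>force+\<close>)
    also have "\<dots> = (\<Sum>s\<in>fst ` Q. 16 ^ s * real (m s)) * (\<Sum>t\<in>snd ` Q. 16 ^ t * real (k t))"
      by (simp only: sum_product sum.cartesian_product)
    also have "\<dots> \<le> (4 * real n) * (4 * real n)"
      by (intro mult_mono sum_m sum_k fin sum_nonneg) auto
    finally show ?thesis by (simp add: power2_eq_square)
  qed
  have ent_a: "(\<Sum>(s, t)\<in>Q. w s t * subset_entropy n (m s)) \<le> 4608 * q * real n"
    unfolding w_def
    by (rule sum_balanced_entropies) (use fin_Q n q Q_up Q_low sum_m[OF fin(1)] entropy_nonneg in auto)
  have ent_b: "(\<Sum>(s, t)\<in>Q. w t s * subset_entropy n (k t)) \<le> 4608 * q * real n"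
  proof -
    have "(\<Sum>(s, t)\<in>Q. w t s * subset_entropy n (k t)) = (\<Sum>(t, s)\<in>prod.swap ` Q. w t s * subset_entropy n (k t))"
      by (subst sum.reindex) (auto simp: case_prod_unfold)
    also have "\<dots> \<le> 4608 * q * real n"
      unfolding w_def
    proof (rule sum_balanced_entropies)
      have "fst ` prod.swap ` Q = snd ` Q" by force
      then show "(\<Sum>s\<in>fst ` prod.swap ` Q. 16 ^ s * real (k s)) \<le> 4 * real n"
        using sum_k[OF fin(2)] by simp
      show "q < 4 ^ (t + s + 2)" if "(t, s) \<in> prod.swap ` Q" for t s
        using that Q_low[of s t] by (auto simp: add.commute)
    qed (use fin_Q n q Q_up' entropy_nonneg in auto)
    finally show ?thesis .
  qed
  have "(\<Sum>e\<in>H. u e * \<bar>a (fst e) * b (snd e)\<bar>)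
      = (\<Sum>z\<in>Q. \<Sum>e | e \<in> H \<and> lev e = z. u e * \<bar>a (fst e) * b (snd e)\<bar>)"
    unfolding Q_def by (rule sum.image_gen[OF fin_H])
  also have "\<dots> \<le> (\<Sum>(s, t)\<in>Q. 768 * q / real n * ((16 ^ s * real (m s)) * (16 ^ t * real (k t)))
       + (K * (w s t * subset_entropy n (m s)) + K * (w t s * subset_entropy n (k t))))"
    by (rule sum_mono) (use cell in auto)
  also have "\<dots> = 768 * q / real n * (\<Sum>(s, t)\<in>Q. (16 ^ s * real (m s)) * (16 ^ t * real (k t)))
       + (K * (\<Sum>(s, t)\<in>Q. w s t * subset_entropy n (m s)) + K * (\<Sum>(s, t)\<in>Q. w t s * subset_entropy n (k t)))"
    by (simp only: case_prod_unfold sum.distrib sum_distrib_left)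
  also have "\<dots> \<le> 768 * q / real n * (16 * (real n)\<^sup>2) + (K * (4608 * q * real n) + K * (4608 * q * real n))"
    using q K by (intro add_mono mult_left_mono main ent_a ent_b) auto
  also have "\<dots> = (12288 + 9216 * K) * q * real n"
    using n by (simp add: field_simps power2_eq_square)
  finally show ?thesis by (simp add: H_def)
qed

section \<open>Counting vertex sets and integer vectors\<close>

text \<open>One term of the binomial expansion of (1 + z)^n is kept, at z = k / n, where (1 + z)^n
  <= exp k.\<close>

lemma binomial_le_exp_entropy:
  assumes "k \<le> n"
  shows "real (n choose k) \<le> exp (subset_entropy n k)"
proof (cases "k = 0")
  case False
  then have k: "k > 0" "n > 0" using assms by auto
  define z where "z = real k / real n"
  have z: "z > 0" using k by (simp add: z_def)
  have "real (n choose k) * z ^ k \<le> (\<Sum>j\<le>n. real (n choose j) * z ^ j)"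
    by (rule member_le_sum) (use assms z in auto)
  also have "\<dots> = (z + 1) ^ n" by (subst binomial_ring) simp
  also have "\<dots> \<le> exp z ^ n"
    using exp_ge_add_one_self[of z] z by (intro power_mono) (auto simp: add.commute)
  also have "\<dots> = exp (real k)" using k by (simp add: z_def flip: exp_of_nat_mult)
  finally have "real (n choose k) \<le> exp (real k) * (1 / z) ^ k"
    using z by (simp add: field_simps)
  also have "(1 / z) ^ k = exp (real k * ln (real n / real k))"
    using k by (simp add: z_def exp_of_nat_mult)
  finally show ?thesis by (simp add: subset_entropy_def algebra_simps flip: exp_add)
qed (simp add: subset_entropy_def)

text \<open>One copy of the entropy pays for the number of sets of each size, the other leaves exp
  (-k) <= 2^(-k). The empty set has to stay out, since its term alone would be 1.\<close>

lemma sum_exp_entropy_le_1: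
  "(\<Sum>I | I \<subseteq> {..<n} \<and> I \<noteq> {}. exp (- 2 * subset_entropy n (card I))) \<le> 1"
proof -
  let ?S = "{I. I \<subseteq> {..<n} \<and> I \<noteq> {}}"
  have fin: "finite ?S" by (rule finite_subset[of _ "Pow {..<n}"]) auto
  have "(\<Sum>I\<in>?S. exp (- 2 * subset_entropy n (card I)))
    = (\<Sum>k\<in>card ` ?S. \<Sum>I | I \<in> ?S \<and> card I = k. exp (- 2 * subset_entropy n (card I)))"
    by (rule sum.image_gen[OF fin])
  also have "\<dots> \<le> (\<Sum>k\<in>card ` ?S. (1 / 2) ^ k)"
  proof (rule sum_mono)
    fix k assume "k \<in> card ` ?S"
    then have k: "k \<le> n" using card_mono[of "{..<n}"] by auto
    have "(\<Sum>I | I \<in> ?S \<and> card I = k. exp (- 2 * subset_entropy n (card I)))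
        = real (card {I \<in> ?S. card I = k}) * exp (- 2 * subset_entropy n k)"
      by simp
    also have "\<dots> \<le> real (n choose k) * exp (- 2 * subset_entropy n k)"
    proof (intro mult_right_mono)
      have "card {I \<in> ?S. card I = k} \<le> card {I. I \<subseteq> {..<n} \<and> card I = k}"
        by (rule card_mono) auto
      then show "real (card {I \<in> ?S. card I = k}) \<le> real (n choose k)"
        using n_subsets[of "{..<n}" k] by simp
    qed auto
    also have "\<dots> \<le> exp (subset_entropy n k) * exp (- 2 * subset_entropy n k)"
      by (intro mult_right_mono binomial_le_exp_entropy k) auto
    also have "\<dots> = exp (- subset_entropy n k)" by (simp flip: exp_add)
    also have "\<dots> \<le> exp (- real k)" using subset_entropy_ge[OF k] by simp
    also have "\<dots> = exp (- 1) ^ k" by (simp flip: exp_of_nat_mult)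
    also have "\<dots> \<le> (1 / 2) ^ k"
      using exp_ge_add_one_self[of 1] by (intro power_mono) (auto simp: exp_minus field_simps)
    finally show "(\<Sum>I | I \<in> ?S \<and> card I = k. exp (- 2 * subset_entropy n (card I))) \<le> (1 / 2) ^ k" .
  qed
  also have "\<dots> \<le> (\<Sum>k\<in>Suc ` {..<n}. (1 / 2) ^ k)"
  proof (rule sum_mono2)
    show "card ` ?S \<subseteq> Suc ` {..<n}"
    proof (rule image_subsetI)
      fix I assume "I \<in> ?S"
      then have I: "I \<subseteq> {..<n}" "I \<noteq> {}" by auto
      then have "card I \<le> n" "card I \<noteq> 0" using card_mono[of "{..<n}" I] finite_subset[of I "{..<n}"] by auto
      then show "card I \<in> Suc ` {..<n}" by (intro image_eqI[of _ _ "card I - 1"]) auto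
    qed
  qed auto
  also have "\<dots> = (1 / 2) * (\<Sum>k<n. (1 / 2) ^ k)"
    by (subst sum.reindex) (auto simp: sum_distrib_left)
  also have "(\<Sum>k<n. (1 / 2 :: real) ^ k) \<le> 2"
    by (subst geometric_sum) auto
  finally show ?thesis by simp
qed

text \<open>With w = z^2, the left side is the tangent at w = R^2 to the function exp (sqrt w). That
  function is convex only for w >= 1; R >= 3 is large enough for the tangent to stay below the graph
  on [0, 1] as well. This serves as a Jensen inequality for sums of squares.\<close>

lemma exp_ge_tangent_sqrt:
  fixes z R :: real
  assumes R: "R \<ge> 3" and z: "z \<ge> 0"
  shows "exp R * (1 + (z\<^sup>2 - R\<^sup>2) / (2 * R)) \<le> exp z"
proof -
  define y where "y = R - z"
  have "1 - y + y\<^sup>2 / (2 * R) \<le> exp (- y)"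
  proof (cases "y \<le> 0")
    case True
    have "y\<^sup>2 / (2 * R) \<le> y\<^sup>2 / 2" using R by (intro divide_left_mono) auto
    then show ?thesis using exp_lower_Taylor_quadratic[of "- y"] True by simp
  next
    case y0: False
    show ?thesis
    proof (cases "y \<le> 2")
      case True
      have "y\<^sup>2 / (2 * R) \<le> y\<^sup>2 / 4" using R by (intro divide_left_mono) auto
      then have "1 - y + y\<^sup>2 / (2 * R) \<le> (1 - y / 2)\<^sup>2" by (simp add: power2_eq_square algebra_simps)
      also have "\<dots> \<le> (exp (- (y / 2)))\<^sup>2"
        using exp_ge_add_one_self[of "- (y / 2)"] True by (intro power_mono) auto
      also have "\<dots> = exp (- y)" by (simp add: power2_eq_square flip: exp_add)
      finally show ?thesis .
    next
      case False
      \<comment> \<open>Since z >= 0, y is at most R; the tangent expression is then at most 1 - y /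
        2, which is no longer positive.\<close>
      have "y * y \<le> y * R" using y0 z by (intro mult_left_mono) (auto simp: y_def)
      then have "y\<^sup>2 / (2 * R) \<le> y / 2" using R by (simp add: field_simps power2_eq_square)
      then have "1 - y + y\<^sup>2 / (2 * R) \<le> 0" using False by simp
      then show ?thesis using exp_ge_zero[of "- y"] by linarith
    qed
  qed
  moreover have "1 - y + y\<^sup>2 / (2 * R) = 1 + (z\<^sup>2 - R\<^sup>2) / (2 * R)"
    using R by (simp add: y_def field_simps power2_eq_square)
  ultimately have "exp R * (1 + (z\<^sup>2 - R\<^sup>2) / (2 * R)) \<le> exp R * exp (- y)"
    by (intro mult_left_mono) auto
  then show ?thesis by (simp add: y_def flip: exp_add)
qed

text \<open>The box excludes no integer vector of the ball, because k^2 <= 4n forces |k| <= 4n; with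
  the extensional domain it makes the set visibly finite. The radius is what rounding a vector of
  squared norm n can produce.\<close>

definition lattice_ball :: "nat \<Rightarrow> (nat \<Rightarrow> int) set" where
  "lattice_ball n = {a \<in> PiE {..<n} (\<lambda>_. {- int (4 * n)..int (4 * n)}). (\<Sum>i<n. (real_of_int (a i))\<^sup>2) \<le> 4 * real n}"

lemma finite_lattice_ball: "finite (lattice_ball n)"
  by (rule finite_subset[of _ "PiE {..<n} (\<lambda>_. {- int (4 * n)..int (4 * n)})"])
     (auto simp: lattice_ball_def intro!: finite_PiE)

text \<open>The subtracted term is there for the induction, which closes because exp 1 >= 2.\<close>

lemma sum_exp_neg_abs_le: "(\<Sum>k = - int m..int m. exp (- \<bar>real_of_int k\<bar>)) \<le> 3 - 2 * exp (- real m)"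
proof (induction m)
  case (Suc m)
  have "{- int (Suc m)..int (Suc m)} = insert (int (Suc m)) (insert (- int (Suc m)) {- int m..int m})"
    by auto
  then have "(\<Sum>k = - int (Suc m)..int (Suc m). exp (- \<bar>real_of_int k\<bar>))
      = 2 * exp (- real (Suc m)) + (\<Sum>k = - int m..int m. exp (- \<bar>real_of_int k\<bar>))" by simp
  also have "\<dots> \<le> 2 * exp (- real (Suc m)) + (3 - 2 * exp (- real m))" using Suc by simp
  also have "\<dots> \<le> 3 - 2 * exp (- real (Suc m))"
  proof -
    have "2 * exp (- real (Suc m)) \<le> exp 1 * exp (- real (Suc m))"
      using exp_ge_add_one_self[of 1] by (intro mult_right_mono) auto
    also have "\<dots> = exp (- real m)" by (simp flip: exp_add)
    finally show ?thesis by simp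
  qed
  finally show ?case .
qed simp

text \<open>Each member gets the weight exp (4n - \<Sum> |a i|), which is at least 1 because |k| <=
  k^2 for integers. Over the whole box these weights factor into n one-dimensional sums, each at
  most 3 <= exp 2.\<close>

lemma card_lattice_ball_le: "real (card (lattice_ball n)) \<le> exp (6 * real n)"
proof -
  let ?Z = "{- int (4 * n)..int (4 * n)}"
  have "real (card (lattice_ball n)) = (\<Sum>a\<in>lattice_ball n. 1)" by simp
  also have "\<dots> \<le> (\<Sum>a\<in>lattice_ball n. exp (4 * real n) * (\<Prod>i<n. exp (- \<bar>real_of_int (a i)\<bar>)))"
  proof (rule sum_mono)
    fix a assume "a \<in> lattice_ball n"
    then have "(\<Sum>i<n. (real_of_int (a i))\<^sup>2) \<le> 4 * real n" by (simp add: lattice_ball_def)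
    moreover have "\<bar>real_of_int k\<bar> \<le> (real_of_int k)\<^sup>2" for k
      using self_le_power[of "\<bar>real_of_int k\<bar>" 2] by (cases "k = 0") auto
    then have "(\<Sum>i<n. \<bar>real_of_int (a i)\<bar>) \<le> (\<Sum>i<n. (real_of_int (a i))\<^sup>2)"
      by (intro sum_mono) auto
    ultimately have "0 \<le> 4 * real n - (\<Sum>i<n. \<bar>real_of_int (a i)\<bar>)" by simp
    then have "1 \<le> exp (4 * real n - (\<Sum>i<n. \<bar>real_of_int (a i)\<bar>))" by simp
    also have "\<dots> = exp (4 * real n + (\<Sum>i<n. - \<bar>real_of_int (a i)\<bar>))" by (simp add: sum_negf)
    also have "\<dots> = exp (4 * real n) * (\<Prod>i<n. exp (- \<bar>real_of_int (a i)\<bar>))"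
      by (simp only: exp_add exp_sum[OF finite_lessThan])
    finally show "1 \<le> exp (4 * real n) * (\<Prod>i<n. exp (- \<bar>real_of_int (a i)\<bar>))" .
  qed
  also have "\<dots> \<le> (\<Sum>a\<in>PiE {..<n} (\<lambda>_. ?Z). exp (4 * real n) * (\<Prod>i<n. exp (- \<bar>real_of_int (a i)\<bar>)))"
  proof (rule sum_mono2)
    show "finite (PiE {..<n} (\<lambda>_. ?Z))" by (intro finite_PiE) auto
    show "lattice_ball n \<subseteq> PiE {..<n} (\<lambda>_. ?Z)" by (auto simp only: lattice_ball_def)
  qed (intro mult_nonneg_nonneg prod_nonneg; simp)
  also have "\<dots> = exp (4 * real n) * (\<Prod>i<n. \<Sum>k\<in>?Z. exp (- \<bar>real_of_int k\<bar>))"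
    by (simp only: sum_distrib_left[symmetric] prod_sum_PiE[OF finite_lessThan] finite_atLeastAtMost_int)
  also have "\<dots> \<le> exp (4 * real n) * (\<Prod>i<n. exp 2)"
  proof (intro mult_left_mono prod_mono conjI)
    have "(\<Sum>k\<in>?Z. exp (- \<bar>real_of_int k\<bar>)) \<le> 3" using sum_exp_neg_abs_le[of "4 * n"] exp_ge_zero[of "- real (4 * n)"] by linarith
    also have "\<dots> \<le> exp 2" using exp_ge_add_one_self[of 2] by simp
    finally show "(\<Sum>k\<in>?Z. exp (- \<bar>real_of_int k\<bar>)) \<le> exp 2" .
  qed (auto intro!: sum_nonneg)
  also have "(\<Prod>i<n. exp 2) = exp (2 * real n)" by (simp add: exp_of_nat2_mult)
  finally have "real (card (lattice_ball n)) \<le> exp (4 * real n + 2 * real n)" by (simp only: exp_add)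
  then show ?thesis by simp
qed

section \<open>Uniform bounds for sparse Bernoulli matrices\<close>

text \<open>All entries at positions in \<open>E\<close> are independent, so \<open>E\<close> cannot
  be a full symmetric matrix; the model is later represented by one triangle.\<close>

locale sparse_bernoulli = bernoulli_product E p
  for E :: "(nat \<times> nat) set" and p :: "nat \<times> nat \<Rightarrow> real" +
  fixes n :: nat and \<Delta> :: real
  assumes n_pos: "n > 0" and \<Delta>_ge_1: "\<Delta> \<ge> 1"
    and E_subset: "E \<subseteq> {..<n} \<times> {..<n}"
    and p_le: "e \<in> E \<Longrightarrow> p e \<le> \<Delta> / real n"
begin

lemma sum_E_square_le:
  fixes f g :: "nat \<Rightarrow> real"
  shows "(\<Sum>e\<in>E. (f (fst e))\<^sup>2 * (g (snd e))\<^sup>2) \<le> (\<Sum>i<n. (f i)\<^sup>2) * (\<Sum>j<n. (g j)\<^sup>2)"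
proof -
  have "(\<Sum>e\<in>E. (f (fst e))\<^sup>2 * (g (snd e))\<^sup>2) \<le> (\<Sum>e\<in>{..<n} \<times> {..<n}. (f (fst e))\<^sup>2 * (g (snd e))\<^sup>2)"
    by (rule sum_mono2) (use E_subset in auto)
  also have "\<dots> = (\<Sum>i<n. (f i)\<^sup>2) * (\<Sum>j<n. (g j)\<^sup>2)"
    by (simp add: sum_product sum.cartesian_product case_prod_unfold)
  finally show ?thesis .
qed

text \<open>
  The exponent is arbitrary, but only finitely many edge counts occur: it suffices to apply Chernoff's
  bound at the least count that violates the inequality.
\<close>

lemma prob_edge_count:
  assumes I: "I \<subseteq> {..<n}" and J: "J \<subseteq> {..<n}"
  shows "measure_pmf.prob law {\<omega>. \<exists>\<theta>\<ge>0. exp \<theta> * (real (card I) * real (card J) * \<Delta> / real n) + L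
      < \<theta> * (\<Sum>e\<in>E \<inter> I \<times> J. of_bool (\<omega> e))} \<le> exp (- L)"
proof -
  define \<mu> where "\<mu> = real (card I) * real (card J) * \<Delta> / real n"
  define N where "N \<omega> = card {e \<in> E \<inter> I \<times> J. \<omega> e}" for \<omega> :: "nat \<times> nat \<Rightarrow> bool"
  define bad where "bad a \<longleftrightarrow> (\<exists>\<theta>\<ge>0. exp \<theta> * \<mu> + L < \<theta> * real a)" for a :: nat
  have N: "(\<Sum>e\<in>E \<inter> I \<times> J. of_bool (\<omega> e)) = real (N \<omega>)" for \<omega>
    using finite_E by (simp add: N_def Int_def)
  show ?thesis
  proof (cases "\<exists>a. bad a")
    case False
    then have "{\<omega>. \<exists>\<theta>\<ge>0. exp \<theta> * \<mu> + L < \<theta> * real (N \<omega>)} = {}" by (auto simp: bad_def)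
    then show ?thesis unfolding N \<mu>_def[symmetric] by (simp only: measure_empty exp_ge_zero)
  next
    case True
    define a where "a = (LEAST a. bad a)"
    have "bad a" using True unfolding a_def by (auto intro: LeastI)
    then obtain \<theta> where \<theta>: "\<theta> \<ge> 0" "exp \<theta> * \<mu> + L < \<theta> * real a" by (auto simp: bad_def)
    define c where "c e = (if e \<in> I \<times> J then \<theta> else 0)" for e
    have sum_c: "(\<Sum>e\<in>E. c e * of_bool (\<omega> e)) = \<theta> * real (N \<omega>)" for \<omega>
    proof -
      have "(\<Sum>e\<in>E. c e * of_bool (\<omega> e)) = (\<Sum>e\<in>E \<inter> I \<times> J. c e * of_bool (\<omega> e))"
        by (rule sum.mono_neutral_right) (auto simp: c_def finite_E)
      also have "\<dots> = (\<Sum>e\<in>E \<inter> I \<times> J. \<theta> * of_bool (\<omega> e))" by (rule sum.cong) (auto simp: c_def)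
      finally show ?thesis by (simp only: sum_distrib_left[symmetric] N)
    qed
    have "(\<Sum>e\<in>E. p e * (exp (c e) - 1)) = (\<Sum>e\<in>E \<inter> I \<times> J. p e * (exp (c e) - 1))"
      by (rule sum.mono_neutral_right) (auto simp: c_def finite_E)
    also have "\<dots> \<le> (\<Sum>e\<in>E \<inter> I \<times> J. \<Delta> / real n * exp \<theta>)"
      using p_nonneg p_le \<theta> \<Delta>_ge_1 by (intro sum_mono mult_mono) (auto simp: c_def)
    also have "\<dots> \<le> (\<Sum>e\<in>I \<times> J. \<Delta> / real n * exp \<theta>)"
      using \<Delta>_ge_1 I J by (intro sum_mono2) (auto intro: finite_subset)
    also have "\<dots> = exp \<theta> * \<mu>" by (simp add: \<mu>_def card_cartesian_product)
    finally have sum_p: "(\<Sum>e\<in>E. p e * (exp (c e) - 1)) \<le> exp \<theta> * \<mu>" .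
    have "measure_pmf.prob law {\<omega>. \<exists>\<theta>\<ge>0. exp \<theta> * \<mu> + L < \<theta> * real (N \<omega>)}
        \<le> measure_pmf.prob law {\<omega>. exp \<theta> * \<mu> + L \<le> (\<Sum>e\<in>E. c e * of_bool (\<omega> e))}"
    proof (rule measure_pmf.finite_measure_mono, safe)
      fix \<omega> \<theta>' assume "0 \<le> \<theta>'" "exp \<theta>' * \<mu> + L < \<theta>' * real (N \<omega>)"
      then have "a \<le> N \<omega>" unfolding a_def by (intro Least_le) (auto simp: bad_def)
      then have "\<theta> * real a \<le> \<theta> * real (N \<omega>)" using \<theta> by (intro mult_left_mono) auto
      then show "exp \<theta> * \<mu> + L \<le> (\<Sum>e\<in>E. c e * of_bool (\<omega> e))" using \<theta> unfolding sum_c by simp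
    qed auto
    also have "\<dots> \<le> exp ((\<Sum>e\<in>E. p e * (exp (c e) - 1)) - (exp \<theta> * \<mu> + L))" by (rule chernoff)
    also have "\<dots> \<le> exp (- L)" using sum_p by simp
    finally show ?thesis unfolding N \<mu>_def .
  qed
qed

text \<open>Optimizing over \<theta> would give the usual upper bound for the edge count in terms of
  its mean and the entropy; the dual form with free \<theta> avoids that bound's case
  distinction.\<close>

definition discrepancy_bound :: "real \<Rightarrow> (nat \<times> nat \<Rightarrow> bool) \<Rightarrow> bool" where
  "discrepancy_bound K \<omega> \<longleftrightarrow> (\<forall>I J \<theta>. I \<subseteq> {..<n} \<longrightarrow> J \<subseteq> {..<n} \<longrightarrow> \<theta> \<ge> 0 \<longrightarrow>
      \<theta> * (\<Sum>e\<in>E \<inter> I \<times> J. of_bool (\<omega> e)) \<le> exp \<theta> * (real (card I) * real (card J) * \<Delta> / real n)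
         + K * (subset_entropy n (card I) + subset_entropy n (card J)))"

text \<open>A union bound over pairs of nonempty sets, the inequality being trivial for empty ones.
  Of 5 * r entropies per set, two pay for the number of sets by \<open>sum_exp_entropy_le_1\<close>;
  the rest is at least 3 * r, because a nonempty set has entropy at least 1.\<close>

lemma prob_discrepancy:
  assumes r: "r \<ge> 1"
  shows "measure_pmf.prob law {\<omega>. \<not> discrepancy_bound (5 * r) \<omega>} \<le> exp (- r - 2)"
proof -
  define \<S> where "\<S> = {I. I \<subseteq> {..<n} \<and> I \<noteq> {}}"
  have fin: "finite \<S>" unfolding \<S>_def by (rule finite_subset[of _ "Pow {..<n}"]) auto
  define L where "L I J = 5 * r * (subset_entropy n (card I) + subset_entropy n (card J))" for I J :: "nat set"
  define B where "B I J = {\<omega>. \<exists>\<theta>\<ge>0. exp \<theta> * (real (card I) * real (card J) * \<Delta> / real n) + L I J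
      < \<theta> * (\<Sum>e\<in>E \<inter> I \<times> J. of_bool (\<omega> e))}" for I J :: "nat set"
  have ent: "subset_entropy n (card I) \<ge> card I" if "I \<subseteq> {..<n}" for I
    using card_mono[OF _ that] by (intro subset_entropy_ge) auto
  have "{\<omega>. \<not> discrepancy_bound (5 * r) \<omega>} \<subseteq> (\<Union>(I, J)\<in>\<S> \<times> \<S>. B I J)"
  proof
    fix \<omega> assume "\<omega> \<in> {\<omega>. \<not> discrepancy_bound (5 * r) \<omega>}"
    then obtain I J \<theta> where *: "I \<subseteq> {..<n}" "J \<subseteq> {..<n}" "\<theta> \<ge> 0"
      "exp \<theta> * (real (card I) * real (card J) * \<Delta> / real n) + L I J
        < \<theta> * (\<Sum>e\<in>E \<inter> I \<times> J. of_bool (\<omega> e))"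
      unfolding discrepancy_bound_def L_def mem_Collect_eq not_all not_imp not_le by blast
    have "0 \<le> exp \<theta> * (real (card I) * real (card J) * \<Delta> / real n) + L I J"
      unfolding L_def using \<Delta>_ge_1 r ent[OF *(1)] ent[OF *(2)] by (intro add_nonneg_nonneg mult_nonneg_nonneg) auto
    then have "(\<Sum>e\<in>E \<inter> I \<times> J. of_bool (\<omega> e)) \<noteq> (0::real)" using *(4) by (metis less_le_not_le mult_zero_right)
    then have "I \<noteq> {}" "J \<noteq> {}" by (metis Int_empty_right Sigma_empty1 Sigma_empty2 sum.empty)+
    then have "(I, J) \<in> \<S> \<times> \<S>" using *(1,2) by (simp add: \<S>_def)
    moreover have "\<omega> \<in> B I J" unfolding B_def using *(3,4) by blast
    ultimately show "\<omega> \<in> (\<Union>(I, J)\<in>\<S> \<times> \<S>. B I J)" by blast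
  qed
  then have "measure_pmf.prob law {\<omega>. \<not> discrepancy_bound (5 * r) \<omega>} 
      \<le> measure_pmf.prob law (\<Union>(I, J)\<in>\<S> \<times> \<S>. B I J)"
    by (intro measure_pmf.finite_measure_mono) auto
  also have "\<dots> \<le> (\<Sum>(I, J)\<in>\<S> \<times> \<S>. measure_pmf.prob law (B I J))"
    using measure_pmf.finite_measure_subadditive_finite[of "\<S> \<times> \<S>" "\<lambda>z. B (fst z) (snd z)" law] fin
    by (simp add: case_prod_unfold)
  also have "\<dots> \<le> (\<Sum>(I, J)\<in>\<S> \<times> \<S>. exp (- (5 * r * subset_entropy n (card I))) * exp (- (5 * r * subset_entropy n (card J))))"
  proof (rule sum_mono, safe)
    fix I J assume "I \<in> \<S>" "J \<in> \<S>"
    then have "measure_pmf.prob law (B I J) \<le> exp (- L I J)"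
      unfolding B_def by (intro prob_edge_count) (auto simp: \<S>_def)
    then show "measure_pmf.prob law (B I J)
      \<le> exp (- (5 * r * subset_entropy n (card I))) * exp (- (5 * r * subset_entropy n (card J)))"
      by (simp add: L_def algebra_simps flip: exp_add)
  qed
  also have "\<dots> = (\<Sum>I\<in>\<S>. exp (- (5 * r * subset_entropy n (card I))))\<^sup>2"
    by (simp only: power2_eq_square sum_product sum.cartesian_product)
  also have "\<dots> \<le> (exp (- 3 * r))\<^sup>2"
  proof (intro power_mono sum_nonneg)
    have "(\<Sum>I\<in>\<S>. exp (- (5 * r * subset_entropy n (card I))))
        \<le> (\<Sum>I\<in>\<S>. exp (- 3 * r) * exp (- 2 * subset_entropy n (card I)))"
    proof (rule sum_mono)
      fix I assume I: "I \<in> \<S>"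
      then have "finite I" "I \<noteq> {}" by (auto simp: \<S>_def intro: finite_subset)
      then have "card I \<ge> 1" by (simp add: Suc_le_eq card_gt_0_iff)
      then have e: "subset_entropy n (card I) \<ge> 1" using ent[of I] I by (auto simp: \<S>_def)
      have "3 * r * 1 + 2 * subset_entropy n (card I) \<le> 3 * r * subset_entropy n (card I) + 2 * r * subset_entropy n (card I)"
        using r e by (intro add_mono mult_left_mono mult_right_mono) auto
      then show "exp (- (5 * r * subset_entropy n (card I))) \<le> exp (- 3 * r) * exp (- 2 * subset_entropy n (card I))"
        by (simp flip: exp_add)
    qed
    also have "\<dots> = exp (- 3 * r) * (\<Sum>I\<in>\<S>. exp (- 2 * subset_entropy n (card I)))"
      by (rule sum_distrib_left[symmetric])
    also have "\<dots> \<le> exp (- 3 * r) * 1"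
      unfolding \<S>_def by (intro mult_left_mono sum_exp_entropy_le_1) auto
    finally show "(\<Sum>I\<in>\<S>. exp (- (5 * r * subset_entropy n (card I)))) \<le> exp (- 3 * r)" by simp
  qed auto
  also have "\<dots> = exp (- 6 * r)" by (simp add: power2_eq_square flip: exp_add)
  also have "\<dots> \<le> exp (- r - 2)" using r by simp
  finally show ?thesis .
qed

definition light_form :: "(nat \<Rightarrow> real) \<Rightarrow> (nat \<Rightarrow> real) \<Rightarrow> (nat \<times> nat \<Rightarrow> bool) \<Rightarrow> real" where
  "light_form a b \<omega> = (\<Sum>e | e \<in> E \<and> \<bar>a (fst e) * b (snd e)\<bar> \<le> sqrt \<Delta>.
     (of_bool (\<omega> e) - p e) * (a (fst e) * b (snd e)))"

text \<open>Divided by sqrt \<Delta>, light coefficients are at most 1 in absolute value, as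
  \<open>bernstein\<close> demands. The variance term is then at most (\<Delta> / n) * (4n)^2 /
  \<Delta> = 16n, comparable to the logarithm of the size of \<open>lattice_ball\<close>.\<close>

lemma prob_light_form:
  assumes a: "(\<Sum>i<n. (a i)\<^sup>2) \<le> 4 * real n" and b: "(\<Sum>i<n. (b i)\<^sup>2) \<le> 4 * real n"
  shows "measure_pmf.prob law {\<omega>. L * sqrt \<Delta> \<le> light_form a b \<omega>} \<le> exp (16 * real n - L)"
proof -
  define q where "q = sqrt \<Delta>"
  have q: "q \<ge> 1" "q\<^sup>2 = \<Delta>" using \<Delta>_ge_1 by (auto simp: q_def)
  define c where "c e = (if \<bar>a (fst e) * b (snd e)\<bar> \<le> q then a (fst e) * b (snd e) / q else 0)" for e
  have "light_form a b \<omega> / q = (\<Sum>e\<in>E. c e * (of_bool (\<omega> e) - p e))" for \<omega>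
    unfolding light_form_def q_def[symmetric] sum_divide_distrib sum.inter_filter[OF finite_E]
    by (rule sum.cong) (simp_all add: c_def)
  then have "{\<omega>. L * sqrt \<Delta> \<le> light_form a b \<omega>} = {\<omega>. L \<le> (\<Sum>e\<in>E. c e * (of_bool (\<omega> e) - p e))}"
    using q by (simp add: q_def[symmetric] pos_le_divide_eq[symmetric])
  also have "measure_pmf.prob law \<dots> \<le> exp ((\<Sum>e\<in>E. p e * (c e)\<^sup>2) - L)"
    by (rule bernstein) (use q in \<open>auto simp: c_def\<close>)
  also have "(\<Sum>e\<in>E. p e * (c e)\<^sup>2) \<le> (\<Sum>e\<in>E. \<Delta> / real n * ((a (fst e))\<^sup>2 * (b (snd e))\<^sup>2 / \<Delta>))"
    using p_le p_nonneg \<Delta>_ge_1 q(2)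
    by (intro sum_mono mult_mono) (auto simp: c_def power_divide power_mult_distrib)
  also have "\<dots> = (\<Sum>e\<in>E. (a (fst e))\<^sup>2 * (b (snd e))\<^sup>2) / real n"
    using \<Delta>_ge_1 unfolding sum_divide_distrib by (intro sum.cong refl) auto
  also have "\<dots> \<le> ((4 * real n) * (4 * real n)) / real n"
    by (intro divide_right_mono order_trans[OF sum_E_square_le] mult_mono a b sum_nonneg) auto
  also have "\<dots> = 16 * real n" using n_pos by simp
  finally show ?thesis by simp
qed

definition light_bound :: "real \<Rightarrow> (nat \<times> nat \<Rightarrow> bool) \<Rightarrow> bool" where
  "light_bound K \<omega> \<longleftrightarrow> (\<forall>a b. (\<forall>i<n. a i \<in> \<int> \<and> b i \<in> \<int>) \<longrightarrow> (\<Sum>i<n. (a i)\<^sup>2) \<le> 4 * real n \<longrightarrow>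
     (\<Sum>i<n. (b i)\<^sup>2) \<le> 4 * real n \<longrightarrow> light_form a b \<omega> \<le> K * real n * sqrt \<Delta>)"

text \<open>31 = 16 + 2 * 6 + 3: the variance term, the choice of two lattice vectors, and 3 r n >=
  r + 2 for the probability.\<close>

lemma prob_light:
  assumes r: "r \<ge> 1"
  shows "measure_pmf.prob law {\<omega>. \<not> light_bound (31 * r) \<omega>} \<le> exp (- r - 2)"
proof -
  let ?V = "lattice_ball n"
  define B where "B a b = {\<omega>. (31 * r * real n) * sqrt \<Delta> \<le> light_form (\<lambda>i. real_of_int (a i)) (\<lambda>i. real_of_int (b i)) \<omega>}" for a b
  have "{\<omega>. \<not> light_bound (31 * r) \<omega>} \<subseteq> (\<Union>(a, b)\<in>?V \<times> ?V. B a b)"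
  proof
    fix \<omega> assume "\<omega> \<in> {\<omega>. \<not> light_bound (31 * r) \<omega>}"
    then obtain a b where ab: "\<And>i. i < n \<Longrightarrow> a i \<in> \<int>" "\<And>i. i < n \<Longrightarrow> b i \<in> \<int>" "(\<Sum>i<n. (a i)\<^sup>2) \<le> 4 * real n"
      "(\<Sum>i<n. (b i)\<^sup>2) \<le> 4 * real n" "31 * r * real n * sqrt \<Delta> < light_form a b \<omega>"
      by (auto simp: light_bound_def not_le)
    \<comment> \<open>The form sees only coordinates below n, so each admissible vector can be
      replaced by its representative in the finite set \<open>lattice_ball n\<close>.\<close>
    define F where "F a = (\<lambda>i\<in>{..<n}. \<lfloor>a i\<rfloor>)" for a :: "nat \<Rightarrow> real"
    have F: "real_of_int (F a i) = a i" if "\<And>i. i < n \<Longrightarrow> a i \<in> \<int>" "i < n" for a i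
      using that by (simp add: F_def of_int_floor_cancel)
    have F_in: "F a \<in> ?V" if aZ: "\<And>i. i < n \<Longrightarrow> a i \<in> \<int>" and norm_a: "(\<Sum>i<n. (a i)\<^sup>2) \<le> 4 * real n" for a
    proof -
      have "F a i \<in> {- int (4 * n)..int (4 * n)}" if i: "i < n" for i
      proof -
        have "(a i)\<^sup>2 \<le> (\<Sum>i<n. (a i)\<^sup>2)" using i by (intro member_le_sum) auto
        then have "(F a i)\<^sup>2 \<le> int (4 * n)"
        proof -
          have "real_of_int ((F a i)\<^sup>2) \<le> real_of_int (int (4 * n))"
            using norm_a F[of a, OF aZ i] \<open>(a i)\<^sup>2 \<le> (\<Sum>i<n. (a i)\<^sup>2)\<close> by simp
          then show ?thesis by (simp only: of_int_le_iff)
        qed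
        moreover have "\<bar>F a i\<bar> \<le> (F a i)\<^sup>2"
          using self_le_power[of "\<bar>F a i\<bar>" 2] by (cases "F a i = 0") auto
        ultimately show ?thesis by auto
      qed
      moreover have "(\<Sum>i<n. (real_of_int (F a i))\<^sup>2) = (\<Sum>i<n. (a i)\<^sup>2)"
        using F[of a, OF aZ] by (intro sum.cong) auto
      ultimately show ?thesis using norm_a by (auto simp: lattice_ball_def F_def)
    qed
    have "light_form (\<lambda>i. real_of_int (F a i)) (\<lambda>i. real_of_int (F b i)) \<omega> = light_form a b \<omega>"
      unfolding light_form_def
    proof (rule sum.cong)
      have *: "real_of_int (F a (fst e)) = a (fst e)" "real_of_int (F b (snd e)) = b (snd e)" if "e \<in> E" for e
        using that E_subset F[of a, OF ab(1)] F[of b, OF ab(2)] by auto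
      then show "{e \<in> E. \<bar>real_of_int (F a (fst e)) * real_of_int (F b (snd e))\<bar> \<le> sqrt \<Delta>}
        = {e \<in> E. \<bar>a (fst e) * b (snd e)\<bar> \<le> sqrt \<Delta>}" by auto
      fix e assume "e \<in> {e \<in> E. \<bar>a (fst e) * b (snd e)\<bar> \<le> sqrt \<Delta>}"
      then show "(of_bool (\<omega> e) - p e) * (real_of_int (F a (fst e)) * real_of_int (F b (snd e)))
        = (of_bool (\<omega> e) - p e) * (a (fst e) * b (snd e))" using * by simp
    qed
    then have "\<omega> \<in> B (F a) (F b)" using ab(5) by (simp add: B_def)
    then show "\<omega> \<in> (\<Union>(a, b)\<in>?V \<times> ?V. B a b)"
      using F_in[of a, OF ab(1,3)] F_in[of b, OF ab(2,4)] by blast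
  qed
  then have "measure_pmf.prob law {\<omega>. \<not> light_bound (31 * r) \<omega>}
      \<le> measure_pmf.prob law (\<Union>(a, b)\<in>?V \<times> ?V. B a b)"
    by (intro measure_pmf.finite_measure_mono) auto
  also have "\<dots> \<le> (\<Sum>(a, b)\<in>?V \<times> ?V. measure_pmf.prob law (B a b))"
    using measure_pmf.finite_measure_subadditive_finite[of "?V \<times> ?V" "\<lambda>z. B (fst z) (snd z)" law] finite_lattice_ball
    by (simp add: case_prod_unfold)
  also have "\<dots> \<le> (\<Sum>(a, b)\<in>?V \<times> ?V. exp (16 * real n - 31 * r * real n))"
  proof (rule sum_mono, safe)
    fix a b assume "a \<in> ?V" "b \<in> ?V"
    then show "measure_pmf.prob law (B a b) \<le> exp (16 * real n - 31 * r * real n)"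
      unfolding B_def by (intro prob_light_form) (auto simp: lattice_ball_def)
  qed
  also have "\<dots> = real (card ?V) * real (card ?V) * exp (16 * real n - 31 * r * real n)"
    by (simp add: case_prod_unfold card_cartesian_product)
  also have "\<dots> \<le> exp (6 * real n) * exp (6 * real n) * exp (16 * real n - 31 * r * real n)"
    by (intro mult_right_mono mult_mono card_lattice_ball_le) auto
  also have "\<dots> = exp (28 * real n - 31 * r * real n)" by (simp flip: exp_add)
  also have "\<dots> \<le> exp (- r - 2)"
  proof -
    have "1 * 1 \<le> r * real n" "r * 1 \<le> r * real n" "1 * real n \<le> r * real n"
      using r n_pos by (intro mult_mono; simp)+
    then show ?thesis by simp
  qed
  finally show ?thesis .
qed

text \<open>exp |t| <= exp t + exp (-t). With weights of size 1 / sqrt \<Delta>, at most n entries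
  have variance term at most 1, so each of the two sides costs at most exp 1 <= 3.\<close>

lemma expectation_exp_abs_le:
  assumes S: "S \<subseteq> E" "card S \<le> n"
  shows "measure_pmf.expectation law (\<lambda>\<omega>. exp (\<bar>\<Sum>e\<in>S. of_bool (\<omega> e) - p e\<bar> / sqrt \<Delta>)) \<le> 6"
proof -
  define q where "q = sqrt \<Delta>"
  have q: "q \<ge> 1" "q\<^sup>2 = \<Delta>" using \<Delta>_ge_1 by (auto simp: q_def)
  have one_sided: "measure_pmf.expectation law (\<lambda>\<omega>. exp (\<sigma> * (\<Sum>e\<in>S. of_bool (\<omega> e) - p e) / q)) \<le> 3"
    if \<sigma>: "\<bar>\<sigma>\<bar> = 1" for \<sigma> :: real
  proof -
    define c where "c e = (if e \<in> S then \<sigma> / q else 0)" for e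
    have "\<sigma> * (\<Sum>e\<in>S. of_bool (\<omega> e) - p e) / q = (\<Sum>e\<in>E. c e * (of_bool (\<omega> e) - p e))" for \<omega>
    proof -
      have "(\<Sum>e\<in>E. c e * (of_bool (\<omega> e) - p e)) = (\<Sum>e\<in>S. c e * (of_bool (\<omega> e) - p e))"
        by (rule sum.mono_neutral_right) (use S finite_E in \<open>auto simp: c_def\<close>)
      also have "\<dots> = (\<Sum>e\<in>S. \<sigma> / q * (of_bool (\<omega> e) - p e))" by (rule sum.cong) (auto simp: c_def)
      finally show ?thesis by (simp only: sum_distrib_left[symmetric]) simp
    qed
    then have "measure_pmf.expectation law (\<lambda>\<omega>. exp (\<sigma> * (\<Sum>e\<in>S. of_bool (\<omega> e) - p e) / q))
      \<le> exp (\<Sum>e\<in>E. p e * (c e)\<^sup>2)"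
      using centered_mgf_le[of c] q \<sigma> by (simp add: c_def)
    also have "(\<Sum>e\<in>E. p e * (c e)\<^sup>2) = (\<Sum>e\<in>S. p e * (c e)\<^sup>2)"
      by (rule sum.mono_neutral_right) (use S finite_E in \<open>auto simp: c_def\<close>)
    also have "\<dots> \<le> (\<Sum>e\<in>S. \<Delta> / real n * (1 / \<Delta>))"
    proof (rule sum_mono)
      fix e assume e: "e \<in> S"
      have "\<sigma>\<^sup>2 = 1" using \<sigma> by (metis power2_abs power_one)
      then have "(c e)\<^sup>2 = 1 / \<Delta>" using q(2) e by (simp add: c_def power_divide)
      then show "p e * (c e)\<^sup>2 \<le> \<Delta> / real n * (1 / \<Delta>)"
        using mult_right_mono[OF p_le[of e], of "1 / \<Delta>"] e S \<Delta>_ge_1 by auto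
    qed
    also have "\<dots> = real (card S) / real n" using \<Delta>_ge_1 by simp
    also have "\<dots> \<le> 1" using S n_pos by simp
    finally show ?thesis using exp_le by simp
  qed
  have "measure_pmf.expectation law (\<lambda>\<omega>. exp (\<bar>\<Sum>e\<in>S. of_bool (\<omega> e) - p e\<bar> / q))
    \<le> measure_pmf.expectation law (\<lambda>\<omega>. exp (1 * (\<Sum>e\<in>S. of_bool (\<omega> e) - p e) / q)
        + exp ((-1) * (\<Sum>e\<in>S. of_bool (\<omega> e) - p e) / q))"
    by (intro Bochner_Integration.integral_mono integrable_law) (auto simp: abs_if)
  also have "\<dots> = measure_pmf.expectation law (\<lambda>\<omega>. exp (1 * (\<Sum>e\<in>S. of_bool (\<omega> e) - p e) / q))
        + measure_pmf.expectation law (\<lambda>\<omega>. exp ((-1) * (\<Sum>e\<in>S. of_bool (\<omega> e) - p e) / q))"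
    by (intro Bochner_Integration.integral_add integrable_law)
  also have "\<dots> \<le> 3 + 3" by (intro add_mono one_sided) auto
  finally show ?thesis by (simp add: q_def)
qed

text \<open>The sets \<open>S i\<close> may overlap, as the stars of two vertices do, so the
  summands are dependent and only linearity of expectation is used. The tangent bound turns a large
  sum of squares into a large sum of exponentials, to which Markov's inequality applies. The shift
  by 4 absorbs the factor 6 <= exp 2 and leaves exp (- r - 2).\<close>

lemma prob_sum_squares:
  assumes r: "r \<ge> 1" and S: "\<And>i. i < n \<Longrightarrow> S i \<subseteq> E" "\<And>i. i < n \<Longrightarrow> card (S i) \<le> n"
  shows "measure_pmf.prob law {\<omega>. (r + 4)\<^sup>2 * real n * \<Delta> \<le> (\<Sum>i<n. (\<Sum>e\<in>S i. of_bool (\<omega> e) - p e)\<^sup>2)}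
    \<le> exp (- r - 2)"
proof -
  define R where "R = r + 4"
  define Z where "Z i \<omega> = \<bar>\<Sum>e\<in>S i. of_bool (\<omega> e) - p e\<bar> / sqrt \<Delta>" for i and \<omega> :: "nat \<times> nat \<Rightarrow> bool"
  have "{\<omega>. R\<^sup>2 * real n * \<Delta> \<le> (\<Sum>i<n. (\<Sum>e\<in>S i. of_bool (\<omega> e) - p e)\<^sup>2)}
    \<subseteq> {\<omega>. real n * exp R \<le> (\<Sum>i<n. exp (Z i \<omega>))}"
  proof safe
    fix \<omega> :: "nat \<times> nat \<Rightarrow> bool"
    assume *: "R\<^sup>2 * real n * \<Delta> \<le> (\<Sum>i<n. (\<Sum>e\<in>S i. of_bool (\<omega> e) - p e)\<^sup>2)"
    have "(\<Sum>i<n. (Z i \<omega>)\<^sup>2) = (\<Sum>i<n. (\<Sum>e\<in>S i. of_bool (\<omega> e) - p e)\<^sup>2) / \<Delta>"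
      using \<Delta>_ge_1 by (simp add: Z_def power_divide sum_divide_distrib)
    then have Z: "R\<^sup>2 * real n \<le> (\<Sum>i<n. (Z i \<omega>)\<^sup>2)" using * \<Delta>_ge_1 by (simp add: pos_le_divide_eq)
    have "real n * exp R \<le> exp R * (real n + ((\<Sum>i<n. (Z i \<omega>)\<^sup>2) - R\<^sup>2 * real n) / (2 * R))"
      using Z r by (simp add: R_def mult_ac)
    also have "\<dots> = (\<Sum>i<n. exp R * (1 + ((Z i \<omega>)\<^sup>2 - R\<^sup>2) / (2 * R)))"
      by (simp add: sum_distrib_left[symmetric] sum.distrib sum_subtractf sum_divide_distrib[symmetric] mult_ac)
    also have "\<dots> \<le> (\<Sum>i<n. exp (Z i \<omega>))"
      using r \<Delta>_ge_1 by (intro sum_mono exp_ge_tangent_sqrt) (auto simp: R_def Z_def)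
    finally show "real n * exp R \<le> (\<Sum>i<n. exp (Z i \<omega>))" .
  qed
  then have "measure_pmf.prob law {\<omega>. R\<^sup>2 * real n * \<Delta> \<le> (\<Sum>i<n. (\<Sum>e\<in>S i. of_bool (\<omega> e) - p e)\<^sup>2)}
    \<le> measure_pmf.prob law {\<omega>. real n * exp R \<le> (\<Sum>i<n. exp (Z i \<omega>))}"
    by (intro measure_pmf.finite_measure_mono) auto
  also have "\<dots> \<le> measure_pmf.expectation law (\<lambda>\<omega>. \<Sum>i<n. exp (Z i \<omega>)) / (real n * exp R)"
    using n_pos by (intro pmf_markov finite_set_law sum_nonneg) auto
  also have "measure_pmf.expectation law (\<lambda>\<omega>. \<Sum>i<n. exp (Z i \<omega>))
      = (\<Sum>i<n. measure_pmf.expectation law (\<lambda>\<omega>. exp (Z i \<omega>)))"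
    by (intro Bochner_Integration.integral_sum integrable_law)
  also have "(\<Sum>i<n. measure_pmf.expectation law (\<lambda>\<omega>. exp (Z i \<omega>))) / (real n * exp R) \<le> (\<Sum>i<n. 6) / (real n * exp R)"
    unfolding Z_def by (intro divide_right_mono sum_mono expectation_exp_abs_le S) auto
  also have "\<dots> = 6 * exp (- R)" using n_pos by (simp add: exp_minus field_simps)
  also have "\<dots> \<le> exp 2 * exp (- R)"
  proof (intro mult_right_mono)
    have "(6::real) \<le> (5 / 2)\<^sup>2" by (simp add: power2_eq_square)
    also have "\<dots> \<le> (exp 1)\<^sup>2" using exp_lower_Taylor_quadratic[of "1::real"] by (intro power_mono) auto
    finally show "6 \<le> exp (2::real)" by (simp flip: exp_of_nat_mult)
  qed auto
  also have "\<dots> = exp (- r - 2)" by (simp add: R_def flip: exp_add)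
  finally show ?thesis by (simp add: R_def)
qed

end

section \<open>Rounding to integer vectors\<close>

text \<open>\<open>c i\<close> stands for the coefficient of \<open>x i\<close> in a form linear in
  that coordinate; its sign decides between ceiling and floor.\<close>

lemma exists_integer_rounding:
  fixes x c :: "nat \<Rightarrow> real"
  shows "\<exists>a. (\<forall>i. a i \<in> \<int> \<and> (a i)\<^sup>2 \<le> 2 * (x i)\<^sup>2 + 2) \<and> (\<forall>i. x i * c i \<le> a i * c i)"
proof (intro exI conjI allI)
  fix i
  define a where "a i = (if c i \<ge> 0 then real_of_int \<lceil>x i\<rceil> else real_of_int \<lfloor>x i\<rfloor>)" for i
  show "(if c i \<ge> 0 then real_of_int \<lceil>x i\<rceil> else real_of_int \<lfloor>x i\<rfloor>) \<in> \<int>" by simp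
  have "\<bar>a i - x i\<bar> \<le> 1" unfolding a_def by (simp, linarith)
  then have "(a i - x i)\<^sup>2 \<le> 1" by (simp add: abs_square_le_1)
  moreover have "(a i)\<^sup>2 + (a i - 2 * x i)\<^sup>2 = 2 * (x i)\<^sup>2 + 2 * (a i - x i)\<^sup>2"
    by (simp add: power2_eq_square algebra_simps)
  ultimately have "(a i)\<^sup>2 \<le> 2 * (x i)\<^sup>2 + 2"
    using zero_le_power2[of "a i - 2 * x i"] by linarith
  then show "(if c i \<ge> 0 then real_of_int \<lceil>x i\<rceil> else real_of_int \<lfloor>x i\<rfloor>)\<^sup>2 \<le> 2 * (x i)\<^sup>2 + 2"
    by (simp add: a_def)
  show "x i * c i \<le> (if c i \<ge> 0 then real_of_int \<lceil>x i\<rceil> else real_of_int \<lfloor>x i\<rfloor>) * c i"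
    by (auto intro: mult_right_mono mult_right_mono_neg)
qed

section \<open>The centered form on real vectors with a degree constraint\<close>

context sparse_bernoulli
begin

definition centered_form :: "(nat \<times> nat \<Rightarrow> bool) \<Rightarrow> (nat \<Rightarrow> real) \<Rightarrow> (nat \<Rightarrow> real) \<Rightarrow> real" where
  "centered_form \<omega> x y = (\<Sum>e\<in>E. (of_bool (\<omega> e) - p e) * (x (fst e) * y (snd e)))"

text \<open>
  Heavy pairs with very unequal coordinates are charged to the degrees; this is where the weight of the
  degrees in the admissible vectors replaces the bounded-degree assumption of Kahn and Szemeredi.
\<close>

lemma centered_form_lattice_le:
  assumes light: "light_bound K \<omega>" and disc: "discrepancy_bound K' \<omega>" and K': "K' \<ge> 0"
    and aZ: "\<And>i. i < n \<Longrightarrow> a i \<in> \<int>" and bZ: "\<And>i. i < n \<Longrightarrow> b i \<in> \<int>"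
    and a: "(\<Sum>i<n. (a i)\<^sup>2) \<le> 4 * real n" and b: "(\<Sum>i<n. (b i)\<^sup>2) \<le> 4 * real n"
    and deg_a: "(\<Sum>e\<in>E. of_bool (\<omega> e) * (a (fst e))\<^sup>2) \<le> M * real n * \<Delta>"
    and deg_b: "(\<Sum>e\<in>E. of_bool (\<omega> e) * (b (snd e))\<^sup>2) \<le> M * real n * \<Delta>"
  shows "centered_form \<omega> a b \<le> (K + 16 + 2 * M + 12288 + 9216 * K') * real n * sqrt \<Delta>"
proof -
  define q where "q = sqrt \<Delta>"
  have q: "q \<ge> 1" "q\<^sup>2 = \<Delta>" "\<Delta> = q * q" using \<Delta>_ge_1 by (auto simp: q_def)
  define u :: "nat \<times> nat \<Rightarrow> real" where "u e = of_bool (\<omega> e)" for e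
  define w where "w e = \<bar>a (fst e) * b (snd e)\<bar>" for e
  define balanced where "balanced e \<longleftrightarrow> q < \<bar>a (fst e) * b (snd e)\<bar> \<and> \<bar>b (snd e)\<bar> < q * \<bar>a (fst e)\<bar>
            \<and> \<bar>a (fst e)\<bar> < q * \<bar>b (snd e)\<bar>" for e
  have u: "u e \<ge> 0" for e by (simp add: u_def)
  \<comment> \<open>The terms on the right are the light part, the edges on balanced heavy pairs,
    the edges on unbalanced heavy pairs charged to the degrees, and the mean on heavy pairs. All but
    the first are nonnegative.\<close>
  have pointwise: "(u e - p e) * (a (fst e) * b (snd e))
     \<le> (if w e \<le> q then (u e - p e) * (a (fst e) * b (snd e)) else 0)
       + (if balanced e then u e * w e else 0)
       + (u e * (a (fst e))\<^sup>2 / q + u e * (b (snd e))\<^sup>2 / q)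
       + (a (fst e))\<^sup>2 * (b (snd e))\<^sup>2 * (q / real n)" if e: "e \<in> E" for e
  proof (cases "w e \<le> q")
    case True
    have "0 \<le> u e * (a (fst e))\<^sup>2 / q" "0 \<le> u e * (b (snd e))\<^sup>2 / q"
      "0 \<le> (a (fst e))\<^sup>2 * (b (snd e))\<^sup>2 * (q / real n)" "0 \<le> u e * w e"
      using q u[of e] by (auto simp: w_def)
    then show ?thesis using True by auto
  next
    case False
    have "(u e - p e) * (a (fst e) * b (snd e)) \<le> \<bar>u e - p e\<bar> * w e"
      by (simp add: w_def abs_mult[symmetric])
    also have "\<dots> \<le> (u e + p e) * w e"
      using u[of e] p_nonneg[OF e] by (intro mult_right_mono) (auto simp: w_def)
    finally have 1: "(u e - p e) * (a (fst e) * b (snd e)) \<le> u e * w e + p e * w e"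
      by (simp add: distrib_right)
    \<comment> \<open>On a heavy pair w <= w^2 / q, so the contribution of the mean is bounded by
      the two norms without any cancellation.\<close>
    have "q * w e \<le> w e * w e" using False by (intro mult_right_mono) (auto simp: w_def)
    also have "\<dots> = (a (fst e))\<^sup>2 * (b (snd e))\<^sup>2"
      by (simp add: w_def power2_eq_square)
    finally have w: "w e \<le> (a (fst e))\<^sup>2 * (b (snd e))\<^sup>2 / q" using q by (simp add: pos_le_divide_eq mult.commute)
    have "p e * w e \<le> \<Delta> / real n * ((a (fst e))\<^sup>2 * (b (snd e))\<^sup>2 / q)"
      using p_le[OF e] \<Delta>_ge_1 by (intro mult_mono w) (auto simp: w_def)
    also have "\<dots> = (a (fst e))\<^sup>2 * (b (snd e))\<^sup>2 * (q / real n)"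
      using q by (simp add: field_simps)
    finally have 2: "p e * w e \<le> (a (fst e))\<^sup>2 * (b (snd e))\<^sup>2 * (q / real n)" .
    have 3: "u e * w e \<le> (if balanced e then u e * w e else 0) + (u e * (a (fst e))\<^sup>2 / q + u e * (b (snd e))\<^sup>2 / q)"
    proof (cases "balanced e")
      case True
      then show ?thesis using q u[of e] by simp
    next
      case unb: False
      \<comment> \<open>If one coordinate is at least q times the other, the product is at most the
        larger square divided by q.\<close>
      have "w e \<le> (a (fst e))\<^sup>2 / q + (b (snd e))\<^sup>2 / q"
      proof (cases "\<bar>b (snd e)\<bar> < q * \<bar>a (fst e)\<bar>")
        case True
        then have "q * \<bar>b (snd e)\<bar> \<le> \<bar>a (fst e)\<bar>" using unb False by (simp add: balanced_def w_def)
        from mult_left_mono[OF this, of "\<bar>a (fst e)\<bar>"]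
        have "w e \<le> (a (fst e))\<^sup>2 / q"
          using q by (simp add: pos_le_divide_eq w_def abs_mult power2_eq_square mult_ac)
        then show ?thesis using q by (simp add: add_increasing2)
      next
        case False
        then have "q * \<bar>a (fst e)\<bar> \<le> \<bar>b (snd e)\<bar>" by simp
        from mult_left_mono[OF this, of "\<bar>b (snd e)\<bar>"]
        have "w e \<le> (b (snd e))\<^sup>2 / q"
          using q by (simp add: pos_le_divide_eq w_def abs_mult power2_eq_square mult_ac)
        then show ?thesis using q by (simp add: add_increasing)
      qed
      from mult_left_mono[OF this u[of e]] show ?thesis using unb by (simp add: distrib_left)
    qed
    show ?thesis using 1 2 3 False by simp
  qed
  have "centered_form \<omega> a b \<le> (\<Sum>e\<in>E. (if w e \<le> q then (u e - p e) * (a (fst e) * b (snd e)) else 0)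
       + (if balanced e then u e * w e else 0)
       + (u e * (a (fst e))\<^sup>2 / q + u e * (b (snd e))\<^sup>2 / q)
       + (a (fst e))\<^sup>2 * (b (snd e))\<^sup>2 * (q / real n))"
    unfolding centered_form_def u_def[symmetric] by (rule sum_mono) (rule pointwise)
  also have "\<dots> = light_form a b \<omega> + (\<Sum>e | e \<in> E \<and> balanced e. u e * w e)
      + ((\<Sum>e\<in>E. u e * (a (fst e))\<^sup>2) / q + (\<Sum>e\<in>E. u e * (b (snd e))\<^sup>2) / q)
      + (\<Sum>e\<in>E. (a (fst e))\<^sup>2 * (b (snd e))\<^sup>2) * (q / real n)"
    unfolding light_form_def sum.inter_filter[OF finite_E] 
    by (simp only: sum.distrib sum_divide_distrib sum_distrib_right u_def w_def q_def)
  also have "light_form a b \<omega> \<le> K * real n * q"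
    using light aZ bZ a b unfolding light_bound_def q_def by blast
  also have "(\<Sum>e | e \<in> E \<and> balanced e. u e * w e) \<le> (12288 + 9216 * K') * q * real n"
    unfolding balanced_def w_def
    by (rule balanced_heavy_sum)
       (use n_pos q K' E_subset u aZ bZ a b disc[unfolded discrepancy_bound_def, folded u_def] in \<open>simp_all\<close>)
  also have "(\<Sum>e\<in>E. u e * (a (fst e))\<^sup>2) / q \<le> (M * real n * \<Delta>) / q"
    using deg_a q unfolding u_def by (intro divide_right_mono) auto
  also have "(\<Sum>e\<in>E. u e * (b (snd e))\<^sup>2) / q \<le> (M * real n * \<Delta>) / q"
    using deg_b q unfolding u_def by (intro divide_right_mono) auto
  also have "(M * real n * \<Delta>) / q = M * real n * q" using q(1) by (simp add: q(3))
  also have "(\<Sum>e\<in>E. (a (fst e))\<^sup>2 * (b (snd e))\<^sup>2) * (q / real n) \<le> (4 * real n) * (4 * real n) * (q / real n)"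
    using q by (intro mult_right_mono order_trans[OF sum_E_square_le] mult_mono a b sum_nonneg) auto
  also have "(4 * real n) * (4 * real n) * (q / real n) = 16 * real n * q" using n_pos by simp
  finally show ?thesis by (simp add: q_def algebra_simps)
qed

lemma sum_E_fst: "(\<Sum>e\<in>E. f e * g (fst e)) = (\<Sum>i<n. (\<Sum>e | e \<in> E \<and> fst e = i. f e) * (g i :: real))"
proof -
  have "(\<Sum>e\<in>E. f e * g (fst e)) = (\<Sum>i<n. \<Sum>e | e \<in> E \<and> fst e = i. f e * g (fst e))"
    by (rule sum.group[symmetric]) (use finite_E E_subset in auto)
  also have "\<dots> = (\<Sum>i<n. (\<Sum>e | e \<in> E \<and> fst e = i. f e) * g i)"
    unfolding sum_distrib_right by (intro sum.cong) auto
  finally show ?thesis .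
qed

lemma sum_E_snd: "(\<Sum>e\<in>E. f e * g (snd e)) = (\<Sum>i<n. (\<Sum>e | e \<in> E \<and> snd e = i. f e) * (g i :: real))"
proof -
  have "(\<Sum>e\<in>E. f e * g (snd e)) = (\<Sum>i<n. \<Sum>e | e \<in> E \<and> snd e = i. f e * g (snd e))"
    by (rule sum.group[symmetric]) (use finite_E E_subset in auto)
  also have "\<dots> = (\<Sum>i<n. (\<Sum>e | e \<in> E \<and> snd e = i. f e) * g i)"
    unfolding sum_distrib_right by (intro sum.cong) auto
  finally show ?thesis .
qed

text \<open>The additive 2 of the rounding brings in the total degree besides the weighted norm: 14
  = 2 * 1 + 2 * 6.\<close>

lemma rounded_norms:
  assumes x: "(\<Sum>i<n. (x i)\<^sup>2) \<le> real n" and a: "\<And>i. (a i)\<^sup>2 \<le> 2 * (x i)\<^sup>2 + 2"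
    and D: "(\<Sum>i<n. D i) \<le> 6 * real n * \<Delta>" and Dx: "(\<Sum>i<n. D i * (x i)\<^sup>2) \<le> real n * \<Delta>"
    and D0: "\<And>i. i < n \<Longrightarrow> D i \<ge> 0" and f: "\<And>i. i < n \<Longrightarrow> f i \<le> D i"
  shows "(\<Sum>i<n. (a i)\<^sup>2) \<le> 4 * real n" "(\<Sum>i<n. f i * (a i)\<^sup>2) \<le> 14 * real n * \<Delta>"
proof -
  have "(\<Sum>i<n. (a i)\<^sup>2) \<le> (\<Sum>i<n. 2 * (x i)\<^sup>2 + 2)" by (intro sum_mono a)
  also have "\<dots> = 2 * (\<Sum>i<n. (x i)\<^sup>2) + 2 * real n" by (simp add: sum.distrib sum_distrib_left)
  finally show "(\<Sum>i<n. (a i)\<^sup>2) \<le> 4 * real n" using x by simp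
  have "(\<Sum>i<n. f i * (a i)\<^sup>2) \<le> (\<Sum>i<n. D i * (2 * (x i)\<^sup>2 + 2))"
    by (intro sum_mono mult_mono a f D0) auto
  also have "\<dots> = 2 * (\<Sum>i<n. D i * (x i)\<^sup>2) + 2 * (\<Sum>i<n. D i)"
    by (simp add: sum.distrib sum_distrib_left algebra_simps)
  finally show "(\<Sum>i<n. f i * (a i)\<^sup>2) \<le> 14 * real n * \<Delta>" using D Dx by simp
qed

text \<open>The vectors are rounded one after the other: the coefficients for \<open>y\<close> are
  formed with the rounded \<open>a\<close> and not with \<open>x\<close>. The constant is 12332 = 16
  + 2 * 14 + 12288.\<close>

lemma centered_form_le:
  assumes light: "light_bound K \<omega>" and disc: "discrepancy_bound K' \<omega>" and K': "K' \<ge> 0"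
    and D: "(\<Sum>i<n. D i) \<le> 6 * real n * \<Delta>"
    and D_fst: "\<And>i. i < n \<Longrightarrow> (\<Sum>e | e \<in> E \<and> fst e = i. of_bool (\<omega> e)) \<le> D i"
    and D_snd: "\<And>i. i < n \<Longrightarrow> (\<Sum>e | e \<in> E \<and> snd e = i. of_bool (\<omega> e)) \<le> D i"
    and x: "(\<Sum>i<n. (x i)\<^sup>2) \<le> real n" and y: "(\<Sum>i<n. (y i)\<^sup>2) \<le> real n"
    and Dx: "(\<Sum>i<n. D i * (x i)\<^sup>2) \<le> real n * \<Delta>" and Dy: "(\<Sum>i<n. D i * (y i)\<^sup>2) \<le> real n * \<Delta>"
  shows "centered_form \<omega> x y \<le> (K + 12332 + 9216 * K') * real n * sqrt \<Delta>"
proof -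
  have D0: "D i \<ge> 0" if "i < n" for i
    by (rule order_trans[OF sum_nonneg D_fst[OF that]]) simp
  define u :: "nat \<times> nat \<Rightarrow> real" where "u e = of_bool (\<omega> e)" for e
  obtain a where a: "\<And>i. a i \<in> \<int>" "\<And>i. (a i)\<^sup>2 \<le> 2 * (x i)\<^sup>2 + 2"
    "\<And>i. x i * (\<Sum>e | e \<in> E \<and> fst e = i. (u e - p e) * y (snd e)) \<le> a i * (\<Sum>e | e \<in> E \<and> fst e = i. (u e - p e) * y (snd e))"
    using exists_integer_rounding[of x "\<lambda>i. \<Sum>e | e \<in> E \<and> fst e = i. (u e - p e) * y (snd e)"] by blast
  obtain b where b: "\<And>i. b i \<in> \<int>" "\<And>i. (b i)\<^sup>2 \<le> 2 * (y i)\<^sup>2 + 2"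
    "\<And>i. y i * (\<Sum>e | e \<in> E \<and> snd e = i. (u e - p e) * a (fst e)) \<le> b i * (\<Sum>e | e \<in> E \<and> snd e = i. (u e - p e) * a (fst e))"
    using exists_integer_rounding[of y "\<lambda>i. \<Sum>e | e \<in> E \<and> snd e = i. (u e - p e) * a (fst e)"] by blast
  have fst_form: "centered_form \<omega> z y = (\<Sum>i<n. z i * (\<Sum>e | e \<in> E \<and> fst e = i. (u e - p e) * y (snd e)))" for z
    using sum_E_fst[of "\<lambda>e. (u e - p e) * y (snd e)" z] by (simp add: centered_form_def u_def mult_ac)
  have snd_form: "centered_form \<omega> a z = (\<Sum>i<n. z i * (\<Sum>e | e \<in> E \<and> snd e = i. (u e - p e) * a (fst e)))" for z
    using sum_E_snd[of "\<lambda>e. (u e - p e) * a (fst e)" z] by (simp add: centered_form_def u_def mult_ac)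
  note norm_a = rounded_norms[OF x a(2) D Dx D0 D_fst]
  note norm_b = rounded_norms[OF y b(2) D Dy D0 D_snd]
  have "centered_form \<omega> x y \<le> centered_form \<omega> a y" unfolding fst_form by (intro sum_mono a(3))
  also have "\<dots> \<le> centered_form \<omega> a b" unfolding snd_form by (intro sum_mono b(3))
  also have "\<dots> \<le> (K + 16 + 2 * 14 + 12288 + 9216 * K') * real n * sqrt \<Delta>"
    using norm_a norm_b sum_E_fst[of "\<lambda>e. of_bool (\<omega> e)" "\<lambda>i. (a i)\<^sup>2"]
      sum_E_snd[of "\<lambda>e. of_bool (\<omega> e)" "\<lambda>i. (b i)\<^sup>2"]
    by (intro centered_form_lattice_le[OF light disc K' a(1) b(1)]) (simp_all only:)
  finally show ?thesis by (simp add: add_ac)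
qed

end

section \<open>Spectral norm and Laplacian\<close>

text \<open>Duality: the form is tested with u = M v / |M v|. If M v = 0, the zero vectors give K >=
  0.\<close>

lemma spectral_norm_le:
  assumes M: "M \<in> carrier_mat n n"
    and K: "\<And>u v. (\<Sum>i<n. (u i)\<^sup>2) \<le> 1 \<Longrightarrow> (\<Sum>i<n. (v i)\<^sup>2) \<le> 1 \<Longrightarrow>
      (\<Sum>i<n. \<Sum>j<n. M $$ (i, j) * (u i * v j)) \<le> K"
  shows "spectral_norm M \<le> K"
  unfolding spectral_norm_def
proof (rule cSUP_least)
  have "0\<^sub>v n \<in> {v \<in> carrier_vec (dim_col M). euclidean_norm v \<le> 1}"
    using M by (auto simp: euclidean_norm_def L2_set_def)
  then show "{v \<in> carrier_vec (dim_col M). euclidean_norm v \<le> 1} \<noteq> {}" by blast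
next
  fix v assume "v \<in> {v \<in> carrier_vec (dim_col M). euclidean_norm v \<le> 1}"
  then have v: "dim_vec v = n" "(\<Sum>i<n. (vec_index v i)\<^sup>2) \<le> 1"
    using M by (auto simp: euclidean_norm_def L2_set_def)
  define w where "w = M *\<^sub>v v"
  define s where "s = euclidean_norm w"
  have w: "vec_index w i = (\<Sum>j<n. M $$ (i, j) * vec_index v j)" if "i < n" for i
    using that M v(1) by (auto simp: w_def scalar_prod_def atLeast0LessThan)
  have s: "s = sqrt (\<Sum>i<n. (vec_index w i)\<^sup>2)"
    using M by (auto simp: s_def w_def euclidean_norm_def L2_set_def)
  have s2: "(\<Sum>i<n. (vec_index w i)\<^sup>2) = s * s" unfolding s by (simp add: sum_nonneg)
  have K0: "0 \<le> K" using K[of "\<lambda>_. 0" "\<lambda>_. 0"] by simp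
  show "euclidean_norm (M *\<^sub>v v) \<le> K"
  proof (cases "s = 0")
    case True
    then show ?thesis using K0 by (simp add: s_def w_def)
  next
    case False
    have "s = (\<Sum>i<n. (vec_index w i)\<^sup>2) / s" using False s2 by simp
    also have "\<dots> = (\<Sum>i<n. vec_index w i / s * vec_index w i)" by (simp add: sum_divide_distrib power2_eq_square)
    also have "\<dots> = (\<Sum>i<n. \<Sum>j<n. M $$ (i, j) * (vec_index w i / s * vec_index v j))"
    proof (rule sum.cong[OF refl])
      fix i assume "i \<in> {..<n}"
      then have "vec_index w i / s * vec_index w i = vec_index w i / s * (\<Sum>j<n. M $$ (i, j) * vec_index v j)" by (simp add: w)
      then show "vec_index w i / s * vec_index w i = (\<Sum>j<n. M $$ (i, j) * (vec_index w i / s * vec_index v j))"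
        by (simp add: sum_distrib_left mult_ac)
    qed
    also have "\<dots> \<le> K"
    proof (rule K)
      show "(\<Sum>i<n. (vec_index w i / s)\<^sup>2) \<le> 1"
        using False s2 by (simp add: power_divide sum_divide_distrib[symmetric] power2_eq_square)
    qed (rule v(2))
    finally show ?thesis by (simp add: s_def w_def)
  qed
qed

section \<open>Entries of regularized Laplacians and normalized forms\<close>

lemma laplacian_carrier: "B \<in> carrier_mat n n \<Longrightarrow> laplacian B \<in> carrier_mat n n"
  by (auto simp: laplacian_def Let_def mat_diag_def)

lemma laplacian_entry:
  assumes B: "B \<in> carrier_mat n n" and ij: "i < n" "j < n"
    and pos: "row_sum B i > 0" "row_sum B j > 0"
  shows "laplacian B $$ (i, j) = of_bool (i = j) - B $$ (i, j) / (sqrt (row_sum B i) * sqrt (row_sum B j))"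
proof -
  have pw: "x powr (- 1 / 2) = 1 / sqrt x" if "x > 0" for x :: real
    using that powr_minus[of x "1 / 2"] by (simp add: powr_half_sqrt inverse_eq_divide)
  define S where "S = mat_diag n (\<lambda>i. row_sum B i powr (- 1 / 2))"
  have S: "S \<in> carrier_mat n n" by (simp add: S_def mat_diag_def)
  have "(S * B * S) $$ (i, j) = row_sum B i powr (- 1 / 2) * B $$ (i, j) * row_sum B j powr (- 1 / 2)"
    unfolding S_def using B ij
    by (subst mat_diag_mult_right[of _ n]) (auto simp: mat_diag_mult_left[of B n n] intro!: mult_carrier_mat)
  moreover have "laplacian B = 1\<^sub>m n - S * B * S" using B by (auto simp: laplacian_def S_def Let_def)
  moreover have "(1\<^sub>m n - S * B * S) $$ (i, j) = of_bool (i = j) - (S * B * S) $$ (i, j)"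
    using S ij by (subst index_minus_mat) auto
  ultimately show ?thesis using pos by (simp only: pw) simp
qed

lemma regularize_carrier: "A \<in> carrier_mat n n \<Longrightarrow> regularize \<tau> A \<in> carrier_mat n n"
  by (auto simp: regularize_def)

lemma regularize_entry:
  "A \<in> carrier_mat n n \<Longrightarrow> i < n \<Longrightarrow> j < n \<Longrightarrow> regularize \<tau> A $$ (i, j) = A $$ (i, j) + \<tau> / real n"
  by (auto simp: regularize_def)

lemma row_sum_regularize:
  assumes "A \<in> carrier_mat n n" "i < n"
  shows "row_sum (regularize \<tau> A) i = (\<Sum>j<n. A $$ (i, j)) + \<tau>"
proof -
  have "row_sum (regularize \<tau> A) i = (\<Sum>j<n. regularize \<tau> A $$ (i, j))"
    using regularize_carrier[OF assms(1), of \<tau>] by (auto simp: row_sum_def)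
  also have "\<dots> = (\<Sum>j<n. A $$ (i, j) + \<tau> / real n)"
    using assms by (intro sum.cong) (auto simp: regularize_entry)
  finally show ?thesis using assms(2) by (simp add: sum.distrib)
qed

text \<open>A Schur test: after x y <= (x^2 + y^2) / 2, each half sums to a squared norm, because
  the rows of \<open>B\<close>, and by symmetry its columns, sum to \<open>d\<close>.\<close>

lemma normalized_form_le_1:
  fixes B :: "nat \<Rightarrow> nat \<Rightarrow> real"
  assumes B: "\<And>i j. i < n \<Longrightarrow> j < n \<Longrightarrow> B i j \<ge> 0" and sym: "\<And>i j. i < n \<Longrightarrow> j < n \<Longrightarrow> B i j = B j i"
    and d: "\<And>i. i < n \<Longrightarrow> d i = (\<Sum>j<n. B i j)" and pos: "\<And>i. i < n \<Longrightarrow> d i > 0"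
    and u: "(\<Sum>i<n. (u i)\<^sup>2) \<le> 1" and v: "(\<Sum>i<n. (v i)\<^sup>2) \<le> 1"
  shows "\<bar>\<Sum>i<n. \<Sum>j<n. B i j / (sqrt (d i) * sqrt (d j)) * (u i * v j)\<bar> \<le> 1"
proof -
  have half: "(\<Sum>i<n. \<Sum>j<n. B i j * ((w i)\<^sup>2 / d i)) \<le> 1" if "(\<Sum>i<n. (w i)\<^sup>2) \<le> 1" for w
  proof -
    have "(\<Sum>i<n. \<Sum>j<n. B i j * ((w i)\<^sup>2 / d i)) = (\<Sum>i<n. (w i)\<^sup>2)"
    proof (rule sum.cong[OF refl])
      fix i assume i: "i \<in> {..<n}"
      have "(\<Sum>j<n. B i j * ((w i)\<^sup>2 / d i)) = d i * ((w i)\<^sup>2 / d i)"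
        using d[of i] i by (simp only: sum_distrib_right[symmetric] lessThan_iff)
      then show "(\<Sum>j<n. B i j * ((w i)\<^sup>2 / d i)) = (w i)\<^sup>2" using pos[of i] i by simp
    qed
    then show ?thesis using that by simp
  qed
  have "\<bar>\<Sum>i<n. \<Sum>j<n. B i j / (sqrt (d i) * sqrt (d j)) * (u i * v j)\<bar>
      \<le> (\<Sum>i<n. \<Sum>j<n. (B i j * ((u i)\<^sup>2 / d i) + B j i * ((v j)\<^sup>2 / d j)) / 2)"
  proof (rule order_trans[OF sum_abs] sum_mono)+
    fix i j assume ij: "i \<in> {..<n}" "j \<in> {..<n}"
    define x y where "x = \<bar>u i\<bar> / sqrt (d i)" and "y = \<bar>v j\<bar> / sqrt (d j)"
    have "\<bar>B i j / (sqrt (d i) * sqrt (d j)) * (u i * v j)\<bar> = B i j * (x * y)"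
      using B[of i j] pos[of i] pos[of j] ij by (simp add: x_def y_def abs_mult)
    also have "\<dots> \<le> B i j * ((x\<^sup>2 + y\<^sup>2) / 2)"
      using B[of i j] ij sum_squares_bound[of x y] by (intro mult_left_mono) auto
    also have "x\<^sup>2 = (u i)\<^sup>2 / d i"
      using pos[of i] ij by (simp add: x_def power_divide)
    also have "y\<^sup>2 = (v j)\<^sup>2 / d j"
      using pos[of j] ij by (simp add: y_def power_divide)
    finally show "\<bar>B i j / (sqrt (d i) * sqrt (d j)) * (u i * v j)\<bar>
      \<le> (B i j * ((u i)\<^sup>2 / d i) + B j i * ((v j)\<^sup>2 / d j)) / 2"
      using sym[of i j] ij by (simp add: algebra_simps)
  qed
  also have "\<dots> = ((\<Sum>i<n. \<Sum>j<n. B i j * ((u i)\<^sup>2 / d i)) + (\<Sum>i<n. \<Sum>j<n. B j i * ((v j)\<^sup>2 / d j))) / 2"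
    by (simp only: sum.distrib sum_divide_distrib[symmetric])
  also have "(\<Sum>i<n. \<Sum>j<n. B j i * ((v j)\<^sup>2 / d j)) = (\<Sum>i<n. \<Sum>j<n. B i j * ((v i)\<^sup>2 / d i))"
    by (rule sum.swap)
  finally show ?thesis using half[OF u] half[OF v] by simp
qed

lemma double_sum_cauchy_schwarz:
  fixes F :: "nat \<Rightarrow> nat \<Rightarrow> real"
  assumes u: "(\<Sum>i<n. (u i)\<^sup>2) \<le> 1" and v: "(\<Sum>i<n. (v i)\<^sup>2) \<le> 1"
  shows "\<bar>\<Sum>i<n. \<Sum>j<n. F i j * (u i * v j)\<bar> \<le> sqrt (\<Sum>i<n. \<Sum>j<n. (F i j)\<^sup>2)"
proof -
  have "(\<Sum>i<n. \<Sum>j<n. F i j * (u i * v j))\<^sup>2 = (\<Sum>z\<in>{..<n} \<times> {..<n}. F (fst z) (snd z) * (u (fst z) * v (snd z)))\<^sup>2"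
    by (simp add: sum.cartesian_product case_prod_unfold)
  also have "\<dots> \<le> (\<Sum>z\<in>{..<n} \<times> {..<n}. (F (fst z) (snd z))\<^sup>2) * (\<Sum>z\<in>{..<n} \<times> {..<n}. (u (fst z) * v (snd z))\<^sup>2)"
    by (rule Cauchy_Schwarz_ineq_sum)
  also have "(\<Sum>z\<in>{..<n} \<times> {..<n}. (F (fst z) (snd z))\<^sup>2) = (\<Sum>i<n. \<Sum>j<n. (F i j)\<^sup>2)"
    by (simp add: sum.cartesian_product case_prod_unfold)
  also have "(\<Sum>z\<in>{..<n} \<times> {..<n}. (u (fst z) * v (snd z))\<^sup>2) = (\<Sum>i<n. (u i)\<^sup>2) * (\<Sum>j<n. (v j)\<^sup>2)"
    by (simp add: sum_product sum.cartesian_product case_prod_unfold power_mult_distrib)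
  also have "(\<Sum>i<n. \<Sum>j<n. (F i j)\<^sup>2) * ((\<Sum>i<n. (u i)\<^sup>2) * (\<Sum>j<n. (v j)\<^sup>2))
    \<le> (\<Sum>i<n. \<Sum>j<n. (F i j)\<^sup>2) * (1 * 1)"
    by (intro mult_left_mono mult_mono u v sum_nonneg) auto
  finally show ?thesis using real_sqrt_le_mono[of _ "\<Sum>i<n. \<Sum>j<n. (F i j)\<^sup>2"] by fastforce
qed

text \<open>Meant for products of two degrees, hence the thresholds \<tau>^2. The denominator sqrt a
  * sqrt b * (sqrt a + sqrt b) is at least 2 * \<tau>^3.\<close>

lemma inverse_sqrt_diff_le:
  fixes a b \<tau> :: real
  assumes "\<tau> > 0" "a \<ge> \<tau>\<^sup>2" "b \<ge> \<tau>\<^sup>2"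
  shows "\<bar>1 / sqrt b - 1 / sqrt a\<bar> \<le> \<bar>a - b\<bar> / (2 * \<tau> ^ 3)"
proof -
  have s: "sqrt a \<ge> \<tau>" "sqrt b \<ge> \<tau>" using assms by (auto intro: real_le_rsqrt)
  then have pos: "sqrt a > 0" "sqrt b > 0" using assms(1) by linarith+
  have ab: "a - b = (sqrt a - sqrt b) * (sqrt a + sqrt b)"
    using pos by (simp add: algebra_simps)
  have "1 / sqrt b - 1 / sqrt a = (sqrt a - sqrt b) / (sqrt a * sqrt b)" using pos by (simp add: field_simps)
  also have "\<dots> = (a - b) / (sqrt a * sqrt b * (sqrt a + sqrt b))"
    unfolding ab using add_pos_pos[OF pos] by simp
  finally have "\<bar>1 / sqrt b - 1 / sqrt a\<bar> = \<bar>a - b\<bar> / (sqrt a * sqrt b * (sqrt a + sqrt b))"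
    using pos by simp
  also have "\<dots> \<le> \<bar>a - b\<bar> / (\<tau> * \<tau> * (\<tau> + \<tau>))"
    using assms(1) s pos by (intro divide_left_mono mult_mono add_mono mult_pos_pos add_pos_pos) auto
  finally show ?thesis by (simp add: power3_eq_cube)
qed

text \<open>
  Replacing the degrees of \<open>A\<close> by those of \<open>B\<close> in the normalization of \<open>B\<close> costs an error that is small
  even in Frobenius norm; this is where the exponent \<open>5 / 2\<close> comes from.
\<close>

lemma normalized_difference_le:
  fixes A B :: "nat \<Rightarrow> nat \<Rightarrow> real"
  assumes n: "n > 0" and \<tau>: "\<tau> > 0" and s: "0 \<le> s" "s \<le> 25 * \<Delta>"
    and dA: "\<And>i. i < n \<Longrightarrow> dA i \<ge> \<tau>" and dB: "\<And>i. i < n \<Longrightarrow> dB i \<ge> \<tau>" "\<And>i. i < n \<Longrightarrow> dB i \<le> \<Delta>"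
    and B: "\<And>i j. i < n \<Longrightarrow> j < n \<Longrightarrow> 0 \<le> B i j" "\<And>i j. i < n \<Longrightarrow> j < n \<Longrightarrow> B i j \<le> \<Delta> / real n"
    and form: "\<And>x y. (\<Sum>i<n. dA i * (x i)\<^sup>2) \<le> 1 \<Longrightarrow> (\<Sum>i<n. dA i * (y i)\<^sup>2) \<le> 1 \<Longrightarrow>
      \<bar>\<Sum>i<n. \<Sum>j<n. (A i j - B i j) * (x i * y j)\<bar> \<le> K"
    and squares: "(\<Sum>i<n. (dA i - dB i)\<^sup>2) \<le> s * real n * \<Delta>"
    and u: "(\<Sum>i<n. (u i)\<^sup>2) \<le> 1" and v: "(\<Sum>i<n. (v i)\<^sup>2) \<le> 1"
  shows "(\<Sum>i<n. \<Sum>j<n. (B i j / (sqrt (dB i) * sqrt (dB j)) - A i j / (sqrt (dA i) * sqrt (dA j))) * (u i * v j))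
    \<le> K + 6 * sqrt s * sqrt (\<Delta> ^ 5 / \<tau> ^ 6)"
proof -
  have \<Delta>: "\<Delta> > 0" using dB[of 0] n \<tau> by linarith
  have pos: "dA i > 0" "dB i > 0" if "i < n" for i using dA[OF that] dB(1)[OF that] \<tau> by linarith+
  define F where "F i j = B i j * (1 / sqrt (dB i * dB j) - 1 / sqrt (dA i * dA j))" for i j
  define x y where "x i = u i / sqrt (dA i)" and "y i = v i / sqrt (dA i)" for i
  \<comment> \<open>\<open>B\<close> normalized by \<open>dA\<close> is added and subtracted. The
    remainder is \<open>A - B\<close> tested on u / sqrt dA and v / sqrt dA, which satisfy the
    weighted constraints of \<open>form\<close>.\<close>
  have split: "(\<Sum>i<n. \<Sum>j<n. (B i j / (sqrt (dB i) * sqrt (dB j)) - A i j / (sqrt (dA i) * sqrt (dA j))) * (u i * v j))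
    = (\<Sum>i<n. \<Sum>j<n. F i j * (u i * v j)) - (\<Sum>i<n. \<Sum>j<n. (A i j - B i j) * (x i * y j))"
    unfolding sum_subtractf[symmetric]
    by (intro sum.cong refl) (simp add: F_def x_def y_def real_sqrt_mult algebra_simps diff_divide_distrib)
  have "(\<Sum>i<n. dA i * (x i)\<^sup>2) = (\<Sum>i<n. (u i)\<^sup>2)" "(\<Sum>i<n. dA i * (y i)\<^sup>2) = (\<Sum>i<n. (v i)\<^sup>2)"
    using pos(1) by (auto intro!: sum.cong simp: x_def y_def power_divide less_imp_le)
      (metis less_irrefl pos(1))+
  then have 1: "\<bar>\<Sum>i<n. \<Sum>j<n. (A i j - B i j) * (x i * y j)\<bar> \<le> K" using u v by (intro form) auto
  have F: "(F i j)\<^sup>2 \<le> \<Delta>\<^sup>2 / (4 * \<tau> ^ 6 * (real n)\<^sup>2) * (2 * ((dA i)\<^sup>2 * (dA j - dB j)\<^sup>2 + (dA i - dB i)\<^sup>2 * (dB j)\<^sup>2))"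
    if ij: "i < n" "j < n" for i j
  proof -
    have "\<tau>\<^sup>2 \<le> dA i * dA j" "\<tau>\<^sup>2 \<le> dB i * dB j"
      unfolding power2_eq_square using dA[OF ij(1)] dA[OF ij(2)] dB(1)[OF ij(1)] dB(1)[OF ij(2)] \<tau>
      by (auto intro!: mult_mono)
    note diff = inverse_sqrt_diff_le[OF \<tau> this]
    have "\<bar>F i j\<bar> = B i j * \<bar>1 / sqrt (dB i * dB j) - 1 / sqrt (dA i * dA j)\<bar>"
      using B(1)[OF ij] by (simp add: F_def abs_mult)
    also have "\<dots> \<le> \<Delta> / real n * (\<bar>dA i * dA j - dB i * dB j\<bar> / (2 * \<tau> ^ 3))"
      using B(1)[OF ij] \<Delta> by (intro mult_mono B diff ij) auto
    finally have "\<bar>F i j\<bar>\<^sup>2 \<le> (\<Delta> / real n * (\<bar>dA i * dA j - dB i * dB j\<bar> / (2 * \<tau> ^ 3)))\<^sup>2"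
      by (intro power_mono) auto
    then have "(F i j)\<^sup>2 \<le> \<Delta>\<^sup>2 / (4 * \<tau> ^ 6 * (real n)\<^sup>2) * (dA i * dA j - dB i * dB j)\<^sup>2"
      by (simp add: power_mult_distrib power_divide mult_ac flip: power_mult)
    also have "\<dots> \<le> \<Delta>\<^sup>2 / (4 * \<tau> ^ 6 * (real n)\<^sup>2) * (2 * ((dA i)\<^sup>2 * (dA j - dB j)\<^sup>2 + (dA i - dB i)\<^sup>2 * (dB j)\<^sup>2))"
    proof (intro mult_left_mono)
      \<comment> \<open>Changing one degree at a time makes each square a function of i times a
        function of j, so that the double sum factors.\<close>
      define p q where "p = dA i * (dA j - dB j)" and "q = (dA i - dB i) * dB j"
      have "dA i * dA j - dB i * dB j = p + q" by (simp add: p_def q_def algebra_simps)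
      moreover have "(p + q)\<^sup>2 \<le> 2 * (p\<^sup>2 + q\<^sup>2)"
        using sum_squares_bound[of p q] by (simp add: power2_sum)
      ultimately show "(dA i * dA j - dB i * dB j)\<^sup>2 \<le> 2 * ((dA i)\<^sup>2 * (dA j - dB j)\<^sup>2 + (dA i - dB i)\<^sup>2 * (dB j)\<^sup>2)"
        by (simp add: p_def q_def power_mult_distrib)
    qed (use \<tau> in auto)
    finally show ?thesis .
  qed
  define \<delta> where "\<delta> = (\<Sum>i<n. (dA i - dB i)\<^sup>2)"
  have \<delta>: "0 \<le> \<delta>" "\<delta> \<le> s * real n * \<Delta>" using squares by (auto simp: \<delta>_def intro: sum_nonneg)
  have sB: "(\<Sum>i<n. (dB i)\<^sup>2) \<le> real n * \<Delta>\<^sup>2"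
  proof -
    have "(\<Sum>i<n. (dB i)\<^sup>2) \<le> (\<Sum>i<n. \<Delta>\<^sup>2)"
      using dB(2) pos(2) by (intro sum_mono power_mono) (auto intro: less_imp_le)
    then show ?thesis by simp
  qed
  \<comment> \<open>Here s <= 25 \<Delta> enters, through 52 = 2 * (1 + 25).\<close>
  have sA: "(\<Sum>i<n. (dA i)\<^sup>2) \<le> 52 * (real n * \<Delta>\<^sup>2)"
  proof -
    have "(\<Sum>i<n. (dA i)\<^sup>2) \<le> (\<Sum>i<n. 2 * ((dB i)\<^sup>2 + (dA i - dB i)\<^sup>2))"
    proof (rule sum_mono)
      fix i
      show "(dA i)\<^sup>2 \<le> 2 * ((dB i)\<^sup>2 + (dA i - dB i)\<^sup>2)"
        using sum_squares_bound[of "dB i" "dA i - dB i"] power2_sum[of "dB i" "dA i - dB i"] by simp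
    qed
    also have "\<dots> = 2 * ((\<Sum>i<n. (dB i)\<^sup>2) + \<delta>)" by (simp add: sum.distrib sum_distrib_left \<delta>_def)
    also have "\<dots> \<le> 2 * (real n * \<Delta>\<^sup>2 + s * real n * \<Delta>)" using sB \<delta> by simp
    also have "s * real n * \<Delta> \<le> 25 * \<Delta> * real n * \<Delta>" using s \<Delta> by (intro mult_right_mono) auto
    finally show ?thesis by (simp add: power2_eq_square algebra_simps)
  qed
  have "(\<Sum>i<n. \<Sum>j<n. (F i j)\<^sup>2)
    \<le> (\<Sum>i<n. \<Sum>j<n. \<Delta>\<^sup>2 / (4 * \<tau> ^ 6 * (real n)\<^sup>2) * (2 * ((dA i)\<^sup>2 * (dA j - dB j)\<^sup>2 + (dA i - dB i)\<^sup>2 * (dB j)\<^sup>2)))"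
    by (intro sum_mono F) auto
  also have "\<dots> = \<Delta>\<^sup>2 / (4 * \<tau> ^ 6 * (real n)\<^sup>2) * (2 * ((\<Sum>i<n. (dA i)\<^sup>2) * \<delta> + \<delta> * (\<Sum>i<n. (dB i)\<^sup>2)))"
    unfolding \<delta>_def sum_product by (simp only: sum.distrib sum_distrib_left[symmetric])
  also have "\<dots> \<le> \<Delta>\<^sup>2 / (4 * \<tau> ^ 6 * (real n)\<^sup>2) * (2 * (52 * (real n * \<Delta>\<^sup>2) * (s * real n * \<Delta>) + s * real n * \<Delta> * (real n * \<Delta>\<^sup>2)))"
    using \<delta> s \<Delta> \<tau> by (intro mult_left_mono add_mono mult_mono sA sB sum_nonneg) auto
  also have "\<dots> = (53 / 2) * (s * (\<Delta> ^ 5 / \<tau> ^ 6))"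
    using n \<tau> by (simp add: field_simps power2_eq_square eval_nat_numeral)
  also have "\<dots> \<le> 36 * (s * (\<Delta> ^ 5 / \<tau> ^ 6))" using s \<Delta> \<tau> by (intro mult_right_mono) auto
  finally have "sqrt (\<Sum>i<n. \<Sum>j<n. (F i j)\<^sup>2) \<le> sqrt (36 * (s * (\<Delta> ^ 5 / \<tau> ^ 6)))" by (rule real_sqrt_le_mono)
  also have "\<dots> = 6 * sqrt s * sqrt (\<Delta> ^ 5 / \<tau> ^ 6)" by (simp only: real_sqrt_mult) (simp add: real_sqrt_unique)
  finally have "\<bar>\<Sum>i<n. \<Sum>j<n. F i j * (u i * v j)\<bar> \<le> 6 * sqrt s * sqrt (\<Delta> ^ 5 / \<tau> ^ 6)"
    using double_sum_cauchy_schwarz[OF u v, of F] by linarith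
  then show ?thesis unfolding split using 1 by linarith
qed

section \<open>The inhomogeneous Erdos-Renyi model\<close>

definition edge_pairs :: "nat \<Rightarrow> (nat \<times> nat) set" where
  "edge_pairs n = {(i, j). i \<le> j \<and> j < n}"

lemma edge_pairs_subset: "edge_pairs n \<subseteq> {..<n} \<times> {..<n}"
  by (auto simp: edge_pairs_def)

lemma finite_edge_pairs: "finite (edge_pairs n)"
  by (rule finite_subset[OF edge_pairs_subset]) auto

text \<open>The independent variables that occur in row i of the symmetric matrix. For fixed i the
  map to (min i j, max i j) is injective, so each occurs once.\<close>

definition star_edges :: "nat \<Rightarrow> nat \<Rightarrow> (nat \<times> nat) set" where
  "star_edges n i = (\<lambda>j. (min i j, max i j)) ` {..<n}"

lemma star_edges_subset: "i < n \<Longrightarrow> star_edges n i \<subseteq> edge_pairs n"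
  by (auto simp: star_edges_def edge_pairs_def min_def max_def)

lemma card_star_edges_le: "card (star_edges n i) \<le> n"
  unfolding star_edges_def using card_image_le[of "{..<n}"] by fastforce

lemma sum_star_edges: "(\<Sum>e\<in>star_edges n i. f e) = (\<Sum>j<n. f (min i j, max i j))"
  unfolding star_edges_def
  by (subst sum.reindex) (auto simp: inj_on_def min_def max_def split: if_splits)

lemma sum_edge_pairs:
  fixes f :: "nat \<times> nat \<Rightarrow> real"
  shows "(\<Sum>e\<in>edge_pairs n. f e) = (\<Sum>i<n. \<Sum>j<n. if i \<le> j then f (i, j) else 0)"
proof -
  have "(\<Sum>e\<in>edge_pairs n. f e) = (\<Sum>e\<in>edge_pairs n. if fst e \<le> snd e then f e else 0)"
    by (rule sum.cong) (auto simp: edge_pairs_def)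
  also have "\<dots> = (\<Sum>e\<in>{..<n} \<times> {..<n}. if fst e \<le> snd e then f e else 0)"
    by (rule sum.mono_neutral_left) (auto simp: edge_pairs_def)
  finally show ?thesis by (simp add: sum.cartesian_product case_prod_unfold cong: if_cong)
qed

text \<open>Positions (i, j) and (j, i) carry the same variable. The symmetric form is therefore the
  sum of two forms of the upper triangle, in which the diagonal is counted twice.\<close>

lemma sum_symmetric_split:
  fixes z :: "nat \<times> nat \<Rightarrow> real"
  shows "(\<Sum>i<n. \<Sum>j<n. z (min i j, max i j) * (x i * y j))
    = (\<Sum>e\<in>edge_pairs n. z e * (x (fst e) * y (snd e))) + (\<Sum>e\<in>edge_pairs n. z e * (y (fst e) * x (snd e)))
      - (\<Sum>i<n. z (i, i) * (x i * y i))"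
proof -
  have "(\<Sum>e\<in>edge_pairs n. z e * (y (fst e) * x (snd e)))
      = (\<Sum>i<n. \<Sum>j<n. if j \<le> i then z (j, i) * (y j * x i) else 0)"
    unfolding sum_edge_pairs by (subst sum.swap) (simp cong: if_cong)
  moreover have "(\<Sum>i<n. z (i, i) * (x i * y i)) = (\<Sum>i<n. \<Sum>j<n. if i = j then z (i, j) * (x i * y j) else 0)"
    by simp
  moreover have "(\<Sum>i<n. \<Sum>j<n. z (min i j, max i j) * (x i * y j))
    = (\<Sum>i<n. \<Sum>j<n. (if i \<le> j then z (i, j) * (x i * y j) else 0) + (if j \<le> i then z (j, i) * (y j * x i) else 0)
      - (if i = j then z (i, j) * (x i * y j) else 0))"
    by (intro sum.cong refl) (auto simp: min_def max_def)
  ultimately show ?thesis by (simp only: sum_edge_pairs sum.distrib sum_subtractf fst_conv snd_conv)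
qed

definition adjacency :: "nat \<Rightarrow> (nat \<times> nat \<Rightarrow> bool) \<Rightarrow> real mat" where
  "adjacency n \<omega> = Matrix.mat n n (\<lambda>(i, j). of_bool (\<omega> (min i j, max i j)))"

locale er_model =
  fixes n :: nat and P :: "real mat" and d \<tau> :: real
  assumes n_ge_1: "n \<ge> 1" and P: "P \<in> carrier_mat n n" and P_sym: "transpose_mat P = P"
    and P_range: "\<forall>i<n. \<forall>j<n. 0 \<le> P $$ (i, j) \<and> P $$ (i, j) \<le> 1"
    and P_le: "\<And>i j. i < n \<Longrightarrow> j < n \<Longrightarrow> real n * P $$ (i, j) \<le> d"
    and \<tau>_pos: "\<tau> > 0"
begin

abbreviation "\<Delta> \<equiv> d + \<tau>"

lemma d_nonneg: "d \<ge> 0"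
  using P_le[of 0 0] P_range n_ge_1 by (metis One_nat_def Suc_le_lessD mult_nonneg_nonneg of_nat_0_le_iff order_trans)

lemma P_entry_le:
  assumes "i < n" "j < n"
  shows "P $$ (i, j) \<le> d / real n"
  using P_le[OF assms] n_ge_1 by (simp add: pos_le_divide_eq mult.commute)

sublocale bernoulli_product "edge_pairs n" "\<lambda>e. P $$ e"
proof
  fix e assume "e \<in> edge_pairs n"
  then obtain i j where "e = (i, j)" "i < n" "j < n" by (auto simp: edge_pairs_def)
  then show "0 \<le> P $$ e" "P $$ e \<le> 1" using P_range by auto
qed (rule finite_edge_pairs)

lemma P_min_max:
  assumes "i < n" "j < n"
  shows "P $$ (min i j, max i j) = P $$ (i, j)"
proof -
  have "P $$ (j, i) = P $$ (i, j)"
    using index_transpose_mat(1)[of j P i] P P_sym assms by auto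
  then show ?thesis by (auto simp: min_def max_def)
qed

lemma inhomogeneous_ER_eq: "inhomogeneous_ER n P = map_pmf (adjacency n) law"
  unfolding law_def unfolding inhomogeneous_ER_def edge_pairs_def adjacency_def ..

lemma expected_mat_eq: "expected_mat n (inhomogeneous_ER n P) = P"
proof (rule eq_matI)
  fix i j assume "i < dim_row P" "j < dim_col P"
  then have ij: "i < n" "j < n" using P by auto
  then have e: "(min i j, max i j) \<in> edge_pairs n" by (auto simp: edge_pairs_def)
  have "expected_mat n (inhomogeneous_ER n P) $$ (i, j)
      = measure_pmf.expectation law (\<lambda>\<omega>. of_bool (\<omega> (min i j, max i j)))"
    using ij by (simp add: expected_mat_def inhomogeneous_ER_eq adjacency_def)
  also have "\<dots> = measure_pmf.expectation (map_pmf (\<lambda>\<omega>. \<omega> (min i j, max i j)) law) of_bool"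
    by simp
  also have "map_pmf (\<lambda>\<omega>. \<omega> (min i j, max i j)) law = bernoulli_pmf (P $$ (min i j, max i j))"
    unfolding law_def using finite_E e by (subst Pi_pmf_component) auto
  also have "measure_pmf.expectation (bernoulli_pmf (P $$ (min i j, max i j))) of_bool = P $$ (i, j)"
    using p_nonneg[OF e] p_le_1[OF e] P_min_max[OF ij] by simp
  finally show "expected_mat n (inhomogeneous_ER n P) $$ (i, j) = P $$ (i, j)" .
qed (use P in \<open>auto simp: expected_mat_def\<close>)

definition A_entry :: "(nat \<times> nat \<Rightarrow> bool) \<Rightarrow> nat \<Rightarrow> nat \<Rightarrow> real" where
  "A_entry \<omega> i j = of_bool (\<omega> (min i j, max i j)) + \<tau> / real n"

definition B_entry :: "nat \<Rightarrow> nat \<Rightarrow> real" where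
  "B_entry i j = P $$ (i, j) + \<tau> / real n"

definition A_deg :: "(nat \<times> nat \<Rightarrow> bool) \<Rightarrow> nat \<Rightarrow> real" where
  "A_deg \<omega> i = (\<Sum>j<n. A_entry \<omega> i j)"

definition B_deg :: "nat \<Rightarrow> real" where
  "B_deg i = (\<Sum>j<n. B_entry i j)"

lemma A_deg_eq: "A_deg \<omega> i = (\<Sum>e\<in>star_edges n i. of_bool (\<omega> e)) + \<tau>"
  using n_ge_1 by (simp only: A_deg_def A_entry_def sum.distrib sum_star_edges) simp

lemma A_deg_ge: "A_deg \<omega> i \<ge> \<tau>"
  unfolding A_deg_eq by (simp only: le_add_same_cancel2) (intro sum_nonneg, simp)

lemma B_deg_eq: "B_deg i = (\<Sum>j<n. P $$ (i, j)) + \<tau>"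
  using n_ge_1 by (simp add: B_deg_def B_entry_def sum.distrib)

lemma B_deg_bounds:
  assumes "i < n"
  shows "\<tau> \<le> B_deg i" "B_deg i \<le> \<Delta>"
proof -
  show "\<tau> \<le> B_deg i" unfolding B_deg_eq using P_range assms by (auto intro!: sum_nonneg)
  have "(\<Sum>j<n. P $$ (i, j)) \<le> (\<Sum>j<n. d / real n)" using assms by (intro sum_mono P_entry_le) auto
  then show "B_deg i \<le> \<Delta>" unfolding B_deg_eq using n_ge_1 by simp
qed

lemma deg_diff:
  assumes "i < n"
  shows "A_deg \<omega> i - B_deg i = (\<Sum>e\<in>star_edges n i. of_bool (\<omega> e) - P $$ e)"
proof -
  have "B_deg i = (\<Sum>e\<in>star_edges n i. P $$ e) + \<tau>"
    using assms by (simp add: B_deg_eq sum_star_edges P_min_max)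
  then show ?thesis by (simp only: A_deg_eq sum_subtractf)
qed

text \<open>The identity matrices of the two Laplacians cancel and the minus signs exchange the
  order, so the expected matrix comes first.\<close>

lemma spectral_norm_le_forms:
  assumes "\<And>u v. (\<Sum>i<n. (u i)\<^sup>2) \<le> 1 \<Longrightarrow> (\<Sum>i<n. (v i)\<^sup>2) \<le> 1 \<Longrightarrow>
    (\<Sum>i<n. \<Sum>j<n. (B_entry i j / (sqrt (B_deg i) * sqrt (B_deg j))
        - A_entry \<omega> i j / (sqrt (A_deg \<omega> i) * sqrt (A_deg \<omega> j))) * (u i * v j)) \<le> K"
  shows "spectral_norm (laplacian (regularize \<tau> (adjacency n \<omega>)) - laplacian (regularize \<tau> P)) \<le> K"
proof (rule spectral_norm_le)
  have A: "adjacency n \<omega> \<in> carrier_mat n n" by (simp add: adjacency_def)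
  have A_ij: "adjacency n \<omega> $$ (i, j) = of_bool (\<omega> (min i j, max i j))" if "i < n" "j < n" for i j
    using that by (simp add: adjacency_def)
  note carriers = laplacian_carrier[OF regularize_carrier[OF A, of \<tau>]] laplacian_carrier[OF regularize_carrier[OF P, of \<tau>]]
  then show "laplacian (regularize \<tau> (adjacency n \<omega>)) - laplacian (regularize \<tau> P) \<in> carrier_mat n n"
    by auto
  have deg_A: "row_sum (regularize \<tau> (adjacency n \<omega>)) i = A_deg \<omega> i" if "i < n" for i
    using that n_ge_1 row_sum_regularize[OF A that]
    by (simp add: A_deg_def A_entry_def sum.distrib adjacency_def)
  have deg_P: "row_sum (regularize \<tau> P) i = B_deg i" if "i < n" for i
    using row_sum_regularize[OF P that] by (simp add: B_deg_eq)
  have entry: "(laplacian (regularize \<tau> (adjacency n \<omega>)) - laplacian (regularize \<tau> P)) $$ (i, j)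
     = B_entry i j / (sqrt (B_deg i) * sqrt (B_deg j)) - A_entry \<omega> i j / (sqrt (A_deg \<omega> i) * sqrt (A_deg \<omega> j))"
    if ij: "i < n" "j < n" for i j
  proof -
    have pos: "A_deg \<omega> k > 0" "B_deg k > 0" if "k < n" for k
      using A_deg_ge[of \<omega> k] B_deg_bounds[OF that] \<tau>_pos by linarith+
    have "laplacian (regularize \<tau> (adjacency n \<omega>)) $$ (i, j)
      = of_bool (i = j) - A_entry \<omega> i j / (sqrt (A_deg \<omega> i) * sqrt (A_deg \<omega> j))"
      using ij pos A by (subst laplacian_entry[OF regularize_carrier[OF A]])
        (simp_all add: deg_A regularize_entry[OF A] A_entry_def A_ij)
    moreover have "laplacian (regularize \<tau> P) $$ (i, j)
      = of_bool (i = j) - B_entry i j / (sqrt (B_deg i) * sqrt (B_deg j))"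
      using ij pos P by (subst laplacian_entry[OF regularize_carrier[OF P]])
        (auto simp: deg_P regularize_entry[OF P] B_entry_def)
    ultimately show ?thesis using carriers ij by auto
  qed
  fix u v :: "nat \<Rightarrow> real" assume uv: "(\<Sum>i<n. (u i)\<^sup>2) \<le> 1" "(\<Sum>i<n. (v i)\<^sup>2) \<le> 1"
  show "(\<Sum>i<n. \<Sum>j<n. (laplacian (regularize \<tau> (adjacency n \<omega>)) - laplacian (regularize \<tau> P)) $$ (i, j) * (u i * v j)) \<le> K"
    using assms[OF uv] by (simp add: entry)
qed

lemma spectral_norm_le_2:
  "spectral_norm (laplacian (regularize \<tau> (adjacency n \<omega>)) - laplacian (regularize \<tau> P)) \<le> 2"
proof (rule spectral_norm_le_forms)
  fix u v :: "nat \<Rightarrow> real" assume uv: "(\<Sum>i<n. (u i)\<^sup>2) \<le> 1" "(\<Sum>i<n. (v i)\<^sup>2) \<le> 1"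
  have "\<bar>\<Sum>i<n. \<Sum>j<n. B_entry i j / (sqrt (B_deg i) * sqrt (B_deg j)) * (u i * v j)\<bar> \<le> 1"
  proof (rule normalized_form_le_1[OF _ _ _ _ uv])
    fix i j assume ij: "i < n" "j < n"
    show "B_entry i j \<ge> 0" using P_range ij \<tau>_pos by (simp add: B_entry_def)
    show "B_entry i j = B_entry j i"
      using P_min_max[of i j] P_min_max[of j i] ij by (simp add: B_entry_def min.commute max.commute)
  next
    fix i assume "i < n"
    then show "B_deg i > 0" using B_deg_bounds[of i] \<tau>_pos by linarith
  qed (simp add: B_deg_def)
  moreover have "\<bar>\<Sum>i<n. \<Sum>j<n. A_entry \<omega> i j / (sqrt (A_deg \<omega> i) * sqrt (A_deg \<omega> j)) * (u i * v j)\<bar> \<le> 1"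
  proof (rule normalized_form_le_1[OF _ _ _ _ uv])
    fix i
    show "A_deg \<omega> i > 0" using A_deg_ge[of \<omega> i] \<tau>_pos by linarith
  qed (use \<tau>_pos in \<open>auto simp: A_deg_def A_entry_def min.commute max.commute\<close>)
  ultimately show "(\<Sum>i<n. \<Sum>j<n. (B_entry i j / (sqrt (B_deg i) * sqrt (B_deg j))
        - A_entry \<omega> i j / (sqrt (A_deg \<omega> i) * sqrt (A_deg \<omega> j))) * (u i * v j)) \<le> 2"
    by (simp only: left_diff_distrib sum_subtractf)
qed

end

section \<open>Large regularization: \<tau> at least 1, hence \<Delta> at least 1\<close>

locale large_er_model = er_model +
  assumes \<tau>_ge_1: "\<tau> \<ge> 1"
begin

sublocale sparse_bernoulli "edge_pairs n" "\<lambda>e. P $$ e" n \<Delta>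
proof
  fix e assume "e \<in> edge_pairs n"
  then obtain i j where e: "e = (i, j)" "i < n" "j < n" by (auto simp: edge_pairs_def)
  have "P $$ e \<le> d / real n" using P_entry_le e by simp
  also have "\<dots> \<le> \<Delta> / real n" using \<tau>_pos by (intro divide_right_mono) auto
  finally show "P $$ e \<le> \<Delta> / real n" .
qed (use n_ge_1 d_nonneg \<tau>_ge_1 edge_pairs_subset in auto)

text \<open>Since degrees are at least \<tau>, the constraint also bounds the squared norm by 1 /
  \<tau>. Scaling by sqrt (n \<tau>) gives the normalization of \<open>centered_form_le\<close> and
  multiplies the form by n \<tau>. The shift \<tau> / n cancels in the difference of entries; the
  two triangles give the factor 2 and the diagonal the term 1 / \<tau>.\<close>

lemma weighted_form_le:
  assumes light: "light_bound K \<omega>" and disc: "discrepancy_bound K' \<omega>" and K': "K' \<ge> 0"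
    and D: "(\<Sum>i<n. A_deg \<omega> i) \<le> 6 * real n * \<Delta>"
    and x: "(\<Sum>i<n. A_deg \<omega> i * (x i)\<^sup>2) \<le> 1" and y: "(\<Sum>i<n. A_deg \<omega> i * (y i)\<^sup>2) \<le> 1"
  shows "\<bar>\<Sum>i<n. \<Sum>j<n. (A_entry \<omega> i j - B_entry i j) * (x i * y j)\<bar>
    \<le> 2 * (K + 12332 + 9216 * K') * sqrt \<Delta> / \<tau> + 1 / \<tau>"
proof -
  define C where "C = K + 12332 + 9216 * K'"
  have norm: "\<tau> * (\<Sum>i<n. (x i)\<^sup>2) \<le> 1" if "(\<Sum>i<n. A_deg \<omega> i * (x i)\<^sup>2) \<le> 1" for x
  proof -
    have "\<tau> * (\<Sum>i<n. (x i)\<^sup>2) \<le> (\<Sum>i<n. A_deg \<omega> i * (x i)\<^sup>2)"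
      unfolding sum_distrib_left by (intro sum_mono mult_right_mono A_deg_ge) auto
    then show ?thesis using that by linarith
  qed
  have one_sided: "centered_form \<omega> x y \<le> C * sqrt \<Delta> / \<tau>"
    if x: "(\<Sum>i<n. A_deg \<omega> i * (x i)\<^sup>2) \<le> 1" and y: "(\<Sum>i<n. A_deg \<omega> i * (y i)\<^sup>2) \<le> 1" for x y
  proof -
    define c where "c = sqrt (real n * \<tau>)"
    have c: "c * c = real n * \<tau>" "c\<^sup>2 = real n * \<tau>" using \<tau>_ge_1 by (auto simp: c_def)
    have scaled: "(\<Sum>i<n. (c * z i)\<^sup>2) \<le> real n" "(\<Sum>i<n. A_deg \<omega> i * (c * z i)\<^sup>2) \<le> real n * \<Delta>"
      if "(\<Sum>i<n. A_deg \<omega> i * (z i)\<^sup>2) \<le> 1" for z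
    proof -
      have "(\<Sum>i<n. (c * z i)\<^sup>2) = real n * (\<tau> * (\<Sum>i<n. (z i)\<^sup>2))"
        by (simp add: power_mult_distrib c sum_distrib_left[symmetric])
      also have "\<dots> \<le> real n * 1" using norm[OF that] by (intro mult_left_mono) auto
      finally show "(\<Sum>i<n. (c * z i)\<^sup>2) \<le> real n" by simp
      have "(\<Sum>i<n. A_deg \<omega> i * (c * z i)\<^sup>2) = real n * \<tau> * (\<Sum>i<n. A_deg \<omega> i * (z i)\<^sup>2)"
        by (simp add: power_mult_distrib c sum_distrib_left mult_ac)
      also have "\<dots> \<le> real n * \<tau> * 1" using that \<tau>_ge_1 by (intro mult_left_mono) auto
      also have "\<dots> \<le> real n * \<Delta>" using d_nonneg by (simp add: mult_left_mono)
      finally show "(\<Sum>i<n. A_deg \<omega> i * (c * z i)\<^sup>2) \<le> real n * \<Delta>" .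
    qed
    have deg: "(\<Sum>e\<in>S. of_bool (\<omega> e)) \<le> A_deg \<omega> i" if "S \<subseteq> star_edges n i" for i S
    proof -
      have "(\<Sum>e\<in>S. of_bool (\<omega> e)) \<le> (\<Sum>e\<in>star_edges n i. of_bool (\<omega> e) :: real)"
        using that by (intro sum_mono2) (auto simp: star_edges_def)
      then show ?thesis unfolding A_deg_eq using \<tau>_ge_1 by linarith
    qed
    have fst_edges: "{e. e \<in> edge_pairs n \<and> fst e = i} \<subseteq> star_edges n i" for i
      by (force simp: edge_pairs_def star_edges_def)
    have snd_edges: "{e. e \<in> edge_pairs n \<and> snd e = i} \<subseteq> star_edges n i" for i
    proof
      fix e assume "e \<in> {e. e \<in> edge_pairs n \<and> snd e = i}"
      then obtain j where "e = (j, i)" "j \<le> i" "i < n" by (auto simp: edge_pairs_def)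
      then show "e \<in> star_edges n i" unfolding star_edges_def by (intro image_eqI[of _ _ j]) auto
    qed
    have "centered_form \<omega> (\<lambda>i. c * x i) (\<lambda>i. c * y i) \<le> C * real n * sqrt \<Delta>"
      unfolding C_def
      by (intro centered_form_le[OF light disc K' D deg[OF fst_edges] deg[OF snd_edges]] scaled x y)
    moreover have "centered_form \<omega> (\<lambda>i. c * x i) (\<lambda>i. c * y i) = c * c * centered_form \<omega> x y"
      by (simp only: centered_form_def sum_distrib_left) (simp add: mult_ac)
    ultimately have "real n * (\<tau> * centered_form \<omega> x y) \<le> real n * (C * sqrt \<Delta>)" by (simp add: c mult_ac)
    then have "\<tau> * centered_form \<omega> x y \<le> C * sqrt \<Delta>" using n_pos by simp
    then show ?thesis using \<tau>_ge_1 by (simp add: pos_le_divide_eq mult.commute)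
  qed
  have two_sided: "\<bar>centered_form \<omega> x y\<bar> \<le> C * sqrt \<Delta> / \<tau>"
    if x: "(\<Sum>i<n. A_deg \<omega> i * (x i)\<^sup>2) \<le> 1" and y: "(\<Sum>i<n. A_deg \<omega> i * (y i)\<^sup>2) \<le> 1" for x y
  proof -
    have "centered_form \<omega> (\<lambda>i. - x i) y = - centered_form \<omega> x y"
      by (simp only: centered_form_def sum_negf[symmetric]) simp
    moreover have "centered_form \<omega> (\<lambda>i. - x i) y \<le> C * sqrt \<Delta> / \<tau>"
      by (rule one_sided) (use x y in auto)
    ultimately show ?thesis using one_sided[OF x y] by linarith
  qed
  define z where "z e = of_bool (\<omega> e) - P $$ e" for e
  have "\<bar>\<Sum>i<n. z (i, i) * (x i * y i)\<bar> \<le> (\<Sum>i<n. ((x i)\<^sup>2 + (y i)\<^sup>2) / 2)"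
  proof (rule order_trans[OF sum_abs] sum_mono)+
    fix i assume "i \<in> {..<n}"
    then have z: "\<bar>z (i, i)\<bar> \<le> 1" using P_range by (auto simp: z_def)
    have "\<bar>z (i, i) * (x i * y i)\<bar> \<le> 1 * (\<bar>x i\<bar> * \<bar>y i\<bar>)"
      unfolding abs_mult by (intro mult_right_mono z) auto
    then show "\<bar>z (i, i) * (x i * y i)\<bar> \<le> ((x i)\<^sup>2 + (y i)\<^sup>2) / 2"
      using sum_squares_bound[of "\<bar>x i\<bar>" "\<bar>y i\<bar>"] by simp
  qed
  also have "\<dots> = ((\<Sum>i<n. (x i)\<^sup>2) + (\<Sum>i<n. (y i)\<^sup>2)) / 2"
    by (simp only: sum.distrib sum_divide_distrib[symmetric])
  also have "\<dots> \<le> (1 / \<tau> + 1 / \<tau>) / 2"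
    using norm[OF x] norm[OF y] \<tau>_ge_1 by (intro divide_right_mono add_mono) (auto simp: pos_le_divide_eq mult.commute)
  finally have diag: "\<bar>\<Sum>i<n. z (i, i) * (x i * y i)\<bar> \<le> 1 / \<tau>" by simp
  have "(\<Sum>i<n. \<Sum>j<n. (A_entry \<omega> i j - B_entry i j) * (x i * y j))
    = (\<Sum>i<n. \<Sum>j<n. z (min i j, max i j) * (x i * y j))"
    by (intro sum.cong refl) (simp add: A_entry_def B_entry_def z_def P_min_max)
  also have "\<dots> = centered_form \<omega> x y + centered_form \<omega> y x - (\<Sum>i<n. z (i, i) * (x i * y i))"
    unfolding sum_symmetric_split[of z] by (simp only: centered_form_def z_def)
  finally have "\<bar>\<Sum>i<n. \<Sum>j<n. (A_entry \<omega> i j - B_entry i j) * (x i * y j)\<bar> \<le> C * sqrt \<Delta> / \<tau> + C * sqrt \<Delta> / \<tau> + 1 / \<tau>"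
    using two_sided[OF x y] two_sided[OF y x] diag by linarith
  then show ?thesis unfolding C_def[symmetric] by simp
qed

definition good :: "real \<Rightarrow> (nat \<times> nat \<Rightarrow> bool) \<Rightarrow> bool" where
  "good r \<omega> \<longleftrightarrow> light_bound (31 * r) \<omega> \<and> discrepancy_bound (5 * r) \<omega> \<and>
     (\<Sum>i<n. (A_deg \<omega> i - B_deg i)\<^sup>2) < (r + 4)\<^sup>2 * real n * \<Delta>"

text \<open>Three exceptional events of probability at most exp (- r - 2) each, and 3 <= exp
  2.\<close>

lemma prob_good:
  assumes r: "r \<ge> 1"
  shows "measure_pmf.prob law {\<omega>. good r \<omega>} \<ge> 1 - exp (- r)"
proof -
  have sq: "(\<Sum>i<n. (A_deg \<omega> i - B_deg i)\<^sup>2) = (\<Sum>i<n. (\<Sum>e\<in>star_edges n i. of_bool (\<omega> e) - P $$ e)\<^sup>2)" for \<omega>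
    by (intro sum.cong refl) (simp only: deg_diff lessThan_iff)
  let ?L = "{\<omega>. \<not> light_bound (31 * r) \<omega>}" and ?D = "{\<omega>. \<not> discrepancy_bound (5 * r) \<omega>}"
    and ?S = "{\<omega>. (r + 4)\<^sup>2 * real n * \<Delta> \<le> (\<Sum>i<n. (A_deg \<omega> i - B_deg i)\<^sup>2)}"
  have bad: "- {\<omega>. good r \<omega>} = ?L \<union> ?D \<union> ?S" by (auto simp: good_def)
  have "measure_pmf.prob law (- {\<omega>. good r \<omega>}) \<le> measure_pmf.prob law ?L + measure_pmf.prob law ?D + measure_pmf.prob law ?S"
    unfolding bad
    by (intro order_trans[OF measure_Un_le] add_mono order_refl measure_Un_le) auto
  also have "\<dots> \<le> exp (- r - 2) + exp (- r - 2) + exp (- r - 2)"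
    unfolding sq
    by (intro add_mono prob_light prob_discrepancy prob_sum_squares r star_edges_subset card_star_edges_le)
  also have "\<dots> = 3 * exp (- 2) * exp (- r)" by (simp add: exp_diff exp_minus divide_inverse)
  also have "\<dots> \<le> 1 * exp (- r)"
    using exp_ge_add_one_self[of 2] by (intro mult_right_mono) (auto simp: exp_minus field_simps)
  finally show ?thesis using measure_pmf.prob_compl[of "{\<omega>. good r \<omega>}" law] by (simp add: Compl_eq_Diff_UNIV)
qed

lemma spectral_norm_good:
  assumes r: "r \<ge> 1" "r\<^sup>2 \<le> \<tau>" and good: "good r \<omega>"
  shows "spectral_norm (laplacian (regularize \<tau> (adjacency n \<omega>)) - laplacian (regularize \<tau> P))
    \<le> 120000 * r\<^sup>2 / sqrt \<tau> * (1 + d / \<tau>) powr (5 / 2)"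
proof -
  define \<rho> where "\<rho> = 1 + d / \<tau>"
  have \<rho>: "\<rho> \<ge> 1" "\<Delta> = \<rho> * \<tau>" using d_nonneg \<tau>_ge_1 by (auto simp: \<rho>_def field_simps)
  define s where "s = (r + 4)\<^sup>2"
  have "s \<le> (5 * r)\<^sup>2" unfolding s_def using r by (intro power_mono) auto
  also have "\<dots> \<le> 25 * \<Delta>" using r d_nonneg by (simp add: power_mult_distrib)
  finally have s: "0 \<le> s" "s \<le> 25 * \<Delta>" by (auto simp: s_def)
  have sqrt_s: "sqrt s = r + 4" using r by (simp add: s_def)
  have squares: "(\<Sum>i<n. (A_deg \<omega> i - B_deg i)\<^sup>2) \<le> s * real n * \<Delta>"
    using good by (simp add: good_def s_def)
  \<comment> \<open>Cauchy-Schwarz bounds the total deviation of the degrees by n * sqrt (s *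
    \<Delta>) <= 5 n \<Delta>; the expected degrees add at most n \<Delta>.\<close>
  have D: "(\<Sum>i<n. A_deg \<omega> i) \<le> 6 * real n * \<Delta>"
  proof -
    have "(\<Sum>i<n. A_deg \<omega> i - B_deg i)\<^sup>2 \<le> (\<Sum>i<n. (A_deg \<omega> i - B_deg i)\<^sup>2) * (\<Sum>i<n. 1\<^sup>2)"
      using Cauchy_Schwarz_ineq_sum[of "\<lambda>i. A_deg \<omega> i - B_deg i" "\<lambda>_. 1" "{..<n}"] by simp
    also have "\<dots> \<le> (25 * \<Delta> * real n * \<Delta>) * real n"
    proof (rule mult_mono)
      have "s * (real n * \<Delta>) \<le> 25 * \<Delta> * (real n * \<Delta>)"
        using s d_nonneg \<tau>_ge_1 by (intro mult_right_mono) auto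
      then show "(\<Sum>i<n. (A_deg \<omega> i - B_deg i)\<^sup>2) \<le> 25 * \<Delta> * real n * \<Delta>" using squares by (simp add: mult_ac)
    qed (use d_nonneg \<tau>_ge_1 in auto)
    also have "\<dots> = (5 * real n * \<Delta>)\<^sup>2" by (simp add: power2_eq_square)
    finally have "(\<Sum>i<n. A_deg \<omega> i - B_deg i) \<le> 5 * real n * \<Delta>"
      by (rule power2_le_imp_le) (use d_nonneg \<tau>_ge_1 in auto)
    moreover have "(\<Sum>i<n. B_deg i) \<le> (\<Sum>i<n. \<Delta>)" by (intro sum_mono B_deg_bounds) auto
    ultimately show ?thesis by (simp add: sum_subtractf)
  qed
  define K where "K = 2 * (31 * r + 12332 + 9216 * (5 * r)) * sqrt \<Delta> / \<tau> + 1 / \<tau>"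
  have "spectral_norm (laplacian (regularize \<tau> (adjacency n \<omega>)) - laplacian (regularize \<tau> P))
    \<le> K + 6 * sqrt s * sqrt (\<Delta> ^ 5 / \<tau> ^ 6)"
  proof (rule spectral_norm_le_forms, rule normalized_difference_le[where \<tau> = \<tau>])
    fix x y :: "nat \<Rightarrow> real"
    assume "(\<Sum>i<n. A_deg \<omega> i * (x i)\<^sup>2) \<le> 1" "(\<Sum>i<n. A_deg \<omega> i * (y i)\<^sup>2) \<le> 1"
    then show "\<bar>\<Sum>i<n. \<Sum>j<n. (A_entry \<omega> i j - B_entry i j) * (x i * y j)\<bar> \<le> K"
      unfolding K_def using good r D by (intro weighted_form_le) (auto simp: good_def)
  next
    fix i j assume ij: "i < n" "j < n"
    show "0 \<le> B_entry i j" using P_range ij \<tau>_ge_1 by (simp add: B_entry_def)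
    show "B_entry i j \<le> \<Delta> / real n" using P_entry_le[OF ij] by (simp add: B_entry_def add_divide_distrib)
  qed (use s squares n_pos \<tau>_ge_1 A_deg_ge B_deg_bounds in auto)
  also have "K + 6 * sqrt s * sqrt (\<Delta> ^ 5 / \<tau> ^ 6) \<le> 120000 * r\<^sup>2 * (\<rho>\<^sup>2 * sqrt \<rho> / sqrt \<tau>)"
  proof -
    define X where "X = \<rho>\<^sup>2 * sqrt \<rho> / sqrt \<tau>"
    have st: "sqrt \<tau> \<ge> 1" "sqrt \<tau> * sqrt \<tau> = \<tau>" using \<tau>_ge_1 by auto
    have sr: "sqrt \<rho> \<ge> 1" "sqrt \<rho> * sqrt \<rho> = \<rho>" using \<rho> by auto
    have r2: "1 \<le> r\<^sup>2" "r \<le> r\<^sup>2" using r by (auto intro: self_le_power)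
    have "\<Delta> ^ 5 / \<tau> ^ 6 = X\<^sup>2"
      using \<rho> \<tau>_ge_1 by (simp add: X_def \<rho>(2) power_mult_distrib power_divide field_simps eval_nat_numeral)
    moreover have X0: "X \<ge> 0" using \<rho> \<tau>_ge_1 by (simp add: X_def)
    ultimately have frob: "sqrt (\<Delta> ^ 5 / \<tau> ^ 6) = X" by simp
    have "sqrt \<Delta> / \<tau> = (sqrt \<rho> * sqrt \<tau>) / (sqrt \<tau> * sqrt \<tau>)"
      by (simp only: \<rho>(2) real_sqrt_mult st(2))
    also have "\<dots> = sqrt \<rho> / sqrt \<tau>"
      by (rule nonzero_mult_divide_mult_cancel_right) (use st in auto)
    also have "\<dots> \<le> X" unfolding X_def
    proof (intro divide_right_mono)
      show "sqrt \<rho> \<le> \<rho>\<^sup>2 * sqrt \<rho>" using \<rho> mult_right_mono[of 1 "\<rho>\<^sup>2" "sqrt \<rho>"] by (simp add: one_le_power)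
    qed (use \<tau>_ge_1 in auto)
    finally have 1: "sqrt \<Delta> / \<tau> \<le> X" .
    have "1 / \<tau> \<le> sqrt \<Delta> / \<tau>" using \<tau>_ge_1 d_nonneg by (intro divide_right_mono) auto
    then have 2: "1 / \<tau> \<le> X" using 1 by linarith
    \<comment> \<open>Since r >= 1, the constants combine to 31 + 12332 + 9216 * 5 = 58443 times r.
      Doubled, and with 1 from the diagonal and 30 from the Frobenius part, they stay below
      120000.\<close>
    have "K \<le> 116886 * (r * X) + X"
    proof -
      have "2 * (31 * r + 12332 + 9216 * (5 * r)) * (sqrt \<Delta> / \<tau>) \<le> 2 * (58443 * r) * X"
        using r \<tau>_ge_1 d_nonneg by (intro mult_mono 1) auto
      then show ?thesis using 2 by (simp add: K_def)
    qed
    moreover have "6 * sqrt s * X \<le> 30 * (r * X)"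
      using mult_right_mono[of "6 * (r + 4)" "30 * r" X] r X0 by (simp add: sqrt_s mult.assoc)
    moreover note mult_right_mono[OF r2(2) X0] mult_right_mono[OF r2(1) X0]
    ultimately have "K + 6 * sqrt s * X \<le> 120000 * (r\<^sup>2 * X)" using X0 by linarith
    then show ?thesis unfolding frob by (simp add: X_def)
  qed
  also have "\<rho>\<^sup>2 * sqrt \<rho> = \<rho> powr (5 / 2)"
  proof -
    have "\<rho> powr (5 / 2) = \<rho> powr (2 + 1 / 2)" by simp
    also have "\<dots> = \<rho> powr 2 * \<rho> powr (1 / 2)" by (rule powr_add)
    finally show ?thesis using \<rho> by (simp add: powr_half_sqrt)
  qed
  finally show ?thesis by (simp add: \<rho>_def)
qed

end

theorem theorem4p1:
  shows "\<exists>C::real. C > 0 \<and>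
    (\<forall>(n::nat) (P::real mat) (d::real) (\<tau>::real) (r::real).
       n \<ge> 1 \<longrightarrow>
       P \<in> carrier_mat n n \<longrightarrow>
       transpose_mat P = P \<longrightarrow>
       (\<forall>i<n. \<forall>j<n. 0 \<le> P $$ (i, j) \<and> P $$ (i, j) \<le> 1) \<longrightarrow>
       d = Max {real n * P $$ (i, j) | i j. i < n \<and> j < n} \<longrightarrow>
       \<tau> > 0 \<longrightarrow>
       r \<ge> 1 \<longrightarrow>
       measure_pmf.prob (inhomogeneous_ER n P)
         {A. spectral_norm
               (laplacian (regularize \<tau> A)
                - laplacian (regularize \<tau> (expected_mat n (inhomogeneous_ER n P))))
             \<le> C * r ^ 2 / sqrt \<tau> * (1 + d / \<tau>) powr (5 / 2)}
         \<ge> 1 - exp (- r))"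
proof (intro exI[of _ "120000::real"] conjI allI impI)
  fix n :: nat and P :: "real mat" and d \<tau> r :: real
  assume n: "n \<ge> 1" and P: "P \<in> carrier_mat n n" "transpose_mat P = P"
    "\<forall>i<n. \<forall>j<n. 0 \<le> P $$ (i, j) \<and> P $$ (i, j) \<le> 1"
    and d: "d = Max {real n * P $$ (i, j) | i j. i < n \<and> j < n}" and \<tau>: "\<tau> > 0" and r: "r \<ge> 1"
  have P_le: "real n * P $$ (i, j) \<le> d" if "i < n" "j < n" for i j
  proof -
    have "{real n * P $$ (i, j) | i j. i < n \<and> j < n} = (\<lambda>(i, j). real n * P $$ (i, j)) ` ({..<n} \<times> {..<n})"
      by auto
    then show ?thesis unfolding d using that by (intro Max_ge) auto
  qed
  interpret er_model n P d \<tau>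
    by unfold_locales (use n P P_le \<tau> in auto)
  define bound where "bound = 120000 * r\<^sup>2 / sqrt \<tau> * (1 + d / \<tau>) powr (5 / 2)"
  let ?D = "\<lambda>\<omega>. laplacian (regularize \<tau> (adjacency n \<omega>)) - laplacian (regularize \<tau> P)"
  have "1 - exp (- r) \<le> measure_pmf.prob law {\<omega>. spectral_norm (?D \<omega>) \<le> bound}"
  proof (cases "bound \<ge> 2")
    case True
    then have "{\<omega>. spectral_norm (?D \<omega>) \<le> bound} = UNIV"
      using spectral_norm_le_2 order_trans by blast
    then show ?thesis by simp
  next
    case False
    have "1 \<le> (1 + d / \<tau>) powr (5 / 2)" using d_nonneg \<tau> by (intro ge_one_powr_ge_zero) auto
    then have "120000 * r\<^sup>2 / sqrt \<tau> * 1 \<le> bound"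
      unfolding bound_def using \<tau> by (intro mult_left_mono) auto
    then have "120000 * r\<^sup>2 / sqrt \<tau> < 2" using False by linarith
    \<comment> \<open>A bound below 2 thus yields r^2 < sqrt \<tau>, and hence both \<tau> >= 1 and
      r^2 <= \<tau>, the conditions under which the probabilistic estimates apply.\<close>
    then have "60000 * r\<^sup>2 < sqrt \<tau>" using \<tau> by (simp add: pos_divide_less_eq)
    then have r2: "r\<^sup>2 < sqrt \<tau>" using zero_le_power2[of r] by linarith
    moreover have "1 \<le> r\<^sup>2" using r by simp
    ultimately have s: "1 \<le> sqrt \<tau>" by linarith
    then have \<tau>1: "\<tau> \<ge> 1" by simp
    have "sqrt \<tau> * 1 \<le> sqrt \<tau> * sqrt \<tau>" using s by (intro mult_left_mono) auto
    then have r\<tau>: "r\<^sup>2 \<le> \<tau>" using r2 \<tau> by simp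
    interpret large_er_model n P d \<tau> by unfold_locales (rule \<tau>1)
    have "1 - exp (- r) \<le> measure_pmf.prob law {\<omega>. good r \<omega>}" by (rule prob_good[OF r])
    also have "\<dots> \<le> measure_pmf.prob law {\<omega>. spectral_norm (?D \<omega>) \<le> bound}"
      using spectral_norm_good[OF r r\<tau>] by (intro measure_pmf.finite_measure_mono) (auto simp: bound_def)
    finally show ?thesis .
  qed
  then show "measure_pmf.prob (inhomogeneous_ER n P)
         {A. spectral_norm
               (laplacian (regularize \<tau> A)
                - laplacian (regularize \<tau> (expected_mat n (inhomogeneous_ER n P))))
             \<le> 120000 * r ^ 2 / sqrt \<tau> * (1 + d / \<tau>) powr (5 / 2)}
         \<ge> 1 - exp (- r)"
    unfolding expected_mat_eq unfolding inhomogeneous_ER_eq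
    by (simp add: bound_def vimage_def)
qed simp

end
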